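(* Let $b\ge1$ be an integer. (i) For every integer $r\ge2$ and every $b$-quasi-bipartite instance satisfying the standing assumptions below, the integrality gap of the linear program $(\mathrm P^{\emptyset}_{ST})$ is at most $\frac{2b+1}{b+1}$. (ii) There exist an integer $r\ge 2$ and a quasi-bipartite (hence $b$-quasi-bipartite) instance satisfying the standing assumptions for which the integrality gap of $(\mathrm P^{\emptyset}_{ST})$ is at least $\frac87$. Thus the worst-case integrality gap of $(\mathrm P^{\emptyset}_{ST})$ on $b$-quasi-bipartite instances lies between $\frac87$ and $\frac{2b+1}{b+1}$.
   Context: An instance of the Steiner tree problem consists of an undirected graph $G=(V,E)$, a terminal set $R\subseteq V$ and nonnegative edge costs $c_e$; vertices of $V\setminus R$ are Steiner vertices. A full component is a tree whose internal vertices are Steiner vertices and whose leaves are terminals. The Steiner neighborhood $S_v$ of a Steiner vertex $v$ is the vertex set of the connected component of $G\setminus R$ containing $v$; the instance is $b$-quasi-bipartite if every Steiner neighborhood has at most $b$ vertices, and quasi-bipartite means $1$-quasi-bipartite. Standing assumptions (preprocessing): (A1) $G[R]$ is complete and for terminals $u,v$, $c_{uv}$ is the cost of a shortest $u$-$v$ path in $G$; (A2) for each Steiner vertex $v$ and each $u\in S_v\cup R$, $uv\in E$ and $c_{uv}$ is the cost of a shortest $u$-$v$ path. Fix $r\ge2$. $\mathcal K_r$ is the family of terminal sets $K$ with $2\le|K|\le r$ that are the terminal set of some full component; each $K\in\mathcal K_r$ is identified with a fixed minimum-cost full component with terminal set $K$ of cost $c_K$ (for $|K|=2$ the edge joining the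 two terminals); Steiner vertices are cloned so that distinct members of $\mathcal K_r$ are edge-disjoint and share only terminals, and $G$ is replaced by the union of all members of $\mathcal K_r$. For a partition $\pi$ of $R$ and $K\in\mathcal K_r$, $\mathrm{rc}^\pi_K$ is the number of parts of $\pi$ containing a terminal of $K$, minus $1$, and $|\pi|$ is the number of parts. The LP $(\mathrm P^{\emptyset}_{ST})$ is: minimize $\sum_{K\in\mathcal K_r}c_Kx_K$ subject to $\sum_{K\in\mathcal K_r}\mathrm{rc}^\pi_Kx_K\ge|\pi|-1$ for every partition $\pi$ of $R$, and $x\ge0$. Its integrality gap on an instance is the ratio of the minimum cost of an integral feasible solution to the minimum cost of a feasible solution. *)

theory Defs
  imports Complex_Main "HOL-Library.Disjoint_Sets" "HOL-Library.Extended_Real"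
begin

section \<open>Graphs\<close>

text \<open>An undirected graph is given by its vertex set and its set of two-element edges.\<close>

definition simple_graph :: "'a set \<Rightarrow> 'a set set \<Rightarrow> bool" where
  "simple_graph V E \<longleftrightarrow> finite V \<and> (\<forall>e\<in>E. e \<subseteq> V \<and> card e = 2)"

definition is_path :: "'a set set \<Rightarrow> 'a \<Rightarrow> 'a \<Rightarrow> 'a list \<Rightarrow> bool" where
  "is_path E u v p \<longleftrightarrow>
     p \<noteq> [] \<and> hd p = u \<and> last p = v \<and> distinct p \<and> successively (\<lambda>x y. {x, y} \<in> E) p"

definition is_cycle :: "'a set set \<Rightarrow> 'a list \<Rightarrow> bool" where
  "is_cycle E p \<longleftrightarrow>
     3 \<le> length p \<and> distinct p \<and> successively (\<lambda>x y. {x, y} \<in> E) p \<and> {last p, hd p} \<in> E"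

definition is_tree :: "'a set \<Rightarrow> 'a set set \<Rightarrow> bool" where
  "is_tree V E \<longleftrightarrow>
     simple_graph V E \<and> V \<noteq> {} \<and> (\<forall>u\<in>V. \<forall>v\<in>V. \<exists>p. is_path E u v p) \<and> (\<nexists>p. is_cycle E p)"

definition degree :: "'a set set \<Rightarrow> 'a \<Rightarrow> nat" where
  "degree E v = card {e \<in> E. v \<in> e}"

definition path_cost :: "('a set \<Rightarrow> real) \<Rightarrow> 'a list \<Rightarrow> real" where
  "path_cost c p = (\<Sum>(x, y)\<leftarrow>zip p (tl p). c {x, y})"

definition is_shortest_path ::
    "'a set set \<Rightarrow> ('a set \<Rightarrow> real) \<Rightarrow> 'a \<Rightarrow> 'a \<Rightarrow> 'a list \<Rightarrow> bool" where
  "is_shortest_path E c u v p \<longleftrightarrow>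
     is_path E u v p \<and> (\<forall>q. is_path E u v q \<longrightarrow> path_cost c p \<le> path_cost c q)"

text \<open>\<open>uv\<close> is an edge whose cost is the cost of a shortest \<open>u\<close>-\<open>v\<close> path.\<close>

definition shortest_edge :: "'a set set \<Rightarrow> ('a set \<Rightarrow> real) \<Rightarrow> 'a \<Rightarrow> 'a \<Rightarrow> bool" where
  "shortest_edge E c u v \<longleftrightarrow>
     {u, v} \<in> E \<and> (\<exists>p. is_shortest_path E c u v p \<and> c {u, v} = path_cost c p)"

section \<open>Steiner tree instances\<close>

definition steiner_instance ::
    "'a set \<Rightarrow> 'a set set \<Rightarrow> 'a set \<Rightarrow> ('a set \<Rightarrow> real) \<Rightarrow> bool" where
  "steiner_instance V E R c \<longleftrightarrow> simple_graph V E \<and> R \<subseteq> V \<and> (\<forall>e\<in>E. 0 \<le> c e)"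

definition steiner_nbhd :: "'a set \<Rightarrow> 'a set set \<Rightarrow> 'a set \<Rightarrow> 'a \<Rightarrow> 'a set" where
  "steiner_nbhd V E R v = {u \<in> V - R. \<exists>p. is_path {e \<in> E. e \<subseteq> V - R} v u p}"

definition quasi_bipartite :: "nat \<Rightarrow> 'a set \<Rightarrow> 'a set set \<Rightarrow> 'a set \<Rightarrow> bool" where
  "quasi_bipartite b V E R \<longleftrightarrow> (\<forall>v\<in>V - R. card (steiner_nbhd V E R v) \<le> b)"

text \<open>
  The Steiner neighborhood of \<open>v\<close> contains \<open>v\<close> itself; the graph has no loops, so the second
  condition skips the case \<open>u = v\<close>.
\<close>

definition preprocessed ::
    "'a set \<Rightarrow> 'a set set \<Rightarrow> 'a set \<Rightarrow> ('a set \<Rightarrow> real) \<Rightarrow> bool" where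
  "preprocessed V E R c \<longleftrightarrow>
     (\<forall>u\<in>R. \<forall>v\<in>R. u \<noteq> v \<longrightarrow> shortest_edge E c u v) \<and>
     (\<forall>v\<in>V - R. \<forall>u\<in>steiner_nbhd V E R v \<union> R. u \<noteq> v \<longrightarrow> shortest_edge E c u v)"

section \<open>Full components\<close>

text \<open>A full component of the instance with vertices \<open>VT\<close>, edges \<open>ET\<close> and terminal set \<open>K\<close>.\<close>

definition full_component ::
    "'a set \<Rightarrow> 'a set set \<Rightarrow> 'a set \<Rightarrow> 'a set \<Rightarrow> 'a set \<Rightarrow> 'a set set \<Rightarrow> bool" where
  "full_component V E R K VT ET \<longleftrightarrow>
     VT \<subseteq> V \<and> ET \<subseteq> E \<and> is_tree VT ET \<and> K = VT \<inter> R \<and>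
     (\<forall>v\<in>VT. if degree ET v = 1 then v \<in> R else v \<in> V - R)"

definition full_comps :: "nat \<Rightarrow> 'a set \<Rightarrow> 'a set set \<Rightarrow> 'a set \<Rightarrow> 'a set set" where
  "full_comps r V E R =
     {K. K \<subseteq> R \<and> 2 \<le> card K \<and> card K \<le> r \<and> (\<exists>VT ET. full_component V E R K VT ET)}"

text \<open>
  The cost of a minimum-cost full component with terminal set \<open>K\<close>. For two terminals in a
  preprocessed instance this is the cost of the edge joining them. The linear program depends
  on the full components only through their terminal sets and these costs, and cloning Steiner
  vertices changes neither.
\<close>

definition comp_cost ::
    "'a set \<Rightarrow> 'a set set \<Rightarrow> 'a set \<Rightarrow> ('a set \<Rightarrow> real) \<Rightarrow> 'a set \<Rightarrow> real" where
  "comp_cost V E R c K = Min {\<Sum>e\<in>ET. c e | VT ET. full_component V E R K VT ET}"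

section \<open>The partition linear program\<close>

definition rank_contrib :: "'a set set \<Rightarrow> 'a set \<Rightarrow> real" where
  "rank_contrib \<pi> K = real (card {P \<in> \<pi>. P \<inter> K \<noteq> {}}) - 1"

definition lp_feasible ::
    "nat \<Rightarrow> 'a set \<Rightarrow> 'a set set \<Rightarrow> 'a set \<Rightarrow> ('a set \<Rightarrow> real) set" where
  "lp_feasible r V E R =
     {x. (\<forall>K\<in>full_comps r V E R. 0 \<le> x K) \<and>
         (\<forall>\<pi>. partition_on R \<pi> \<longrightarrow>
            real (card \<pi>) - 1 \<le> (\<Sum>K\<in>full_comps r V E R. rank_contrib \<pi> K * x K))}"

definition ip_feasible ::
    "nat \<Rightarrow> 'a set \<Rightarrow> 'a set set \<Rightarrow> 'a set \<Rightarrow> ('a set \<Rightarrow> real) set" where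
  "ip_feasible r V E R = {x \<in> lp_feasible r V E R. \<forall>K\<in>full_comps r V E R. x K \<in> \<int>}"

definition lp_cost ::
    "nat \<Rightarrow> 'a set \<Rightarrow> 'a set set \<Rightarrow> 'a set \<Rightarrow> ('a set \<Rightarrow> real) \<Rightarrow> ('a set \<Rightarrow> real) \<Rightarrow> real" where
  "lp_cost r V E R c x = (\<Sum>K\<in>full_comps r V E R. comp_cost V E R c K * x K)"

text \<open>
  Both programs are feasible for preprocessed instances and \<open>r \<ge> 2\<close>, and the infima are
  attained. Division is in the extended reals: a positive integral optimum over a fractional optimum of
  \<open>0\<close> gives \<open>\<infinity>\<close>; only the degenerate ratio \<open>0 / 0\<close> is \<open>0\<close>.
\<close>

definition integrality_gap ::
    "nat \<Rightarrow> 'a set \<Rightarrow> 'a set set \<Rightarrow> 'a set \<Rightarrow> ('a set \<Rightarrow> real) \<Rightarrow> ereal" where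
  "integrality_gap r V E R c =
     (INF x\<in>ip_feasible r V E R. ereal (lp_cost r V E R c x)) /
     (INF x\<in>lp_feasible r V E R. ereal (lp_cost r V E R c x))"

text \<open>The supremum is over instances with vertices in \<^typ>\<open>nat\<close>, which up to isomorphism are
  all finite instances.\<close>

definition worst_case_gap :: "nat \<Rightarrow> ereal" where
  "worst_case_gap b =
     Sup {integrality_gap r V E R c | r (V :: nat set) E R c.
            2 \<le> r \<and> steiner_instance V E R c \<and> preprocessed V E R c \<and> quasi_bipartite b V E R}"

end

theory Submission
  imports Defs
begin

text \<open>
  For the upper bound, take a cheapest connected family of full components. In each of its trees
  choose edges (the loss) that connect every Steiner vertex to a terminal, and contract them; the
  other edges become edges between terminals, and together they connect all terminals. By
  optimality, edges of the contracted graph that become superfluous when a component \<open>K\<close> is added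
  cost at most \<open>c\<^sub>K\<close>. A fractional solution can exchange the whole contracted tree in this way, so the
  tree costs no more than the fractional solution. As the loss is at most a fraction
  \<open>b / (2 b + 1)\<close> of the cost of a component, the bound follows.

  For the lower bound, Skutella's instance on the Fano plane has a fractional solution of cost
  \<open>35 / 4\<close>, but no integral one of cost less than \<open>10\<close>.
\<close>

section \<open>Connectivity and bridges\<close>

text \<open>A tree edge at a Steiner vertex does not join two terminals, so it cannot be compared
  with partitions of \<open>R\<close>. Keeping the loss in every tree overcomes this: each Steiner
  vertex stays tied to one terminal, and after deleting any other edges the remaining pieces that
  hold at least two terminals are again full components, of total cost at most that of the remaining
  edges. Optimality then speaks about the deleted edges alone. The fractional exchange is the dual
  of Kruskal's algorithm: the partitions met while contracting cheapest edges are the constraints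
  that pay. The factor arises because a tree without its loss keeps at least
  \<open>(b + 1) / (2 b + 1)\<close> of its cost.

  Partitions, contractions and connectivity are all expressed by functions on vertices: a partition
  consists of the fibres of a map, a contraction merges two values, and a family connects
  \<open>R\<close> if every map constant on its members is constant on \<open>R\<close>. Steiner
  vertices are not cloned; instead, tree edges are paired with the component they are used
  for.\<close>

definition conn :: "'a set set \<Rightarrow> 'a \<Rightarrow> 'a \<Rightarrow> bool" where
  "conn F x y \<longleftrightarrow> (x, y) \<in> {(u, v). {u, v} \<in> F}\<^sup>*"

lemma conn_refl [simp]: "conn F x x"
  by (simp add: conn_def)

lemma conn_edge: "{x, y} \<in> F \<Longrightarrow> conn F x y"
  by (auto simp: conn_def)

lemma conn_trans [trans]: "conn F x y \<Longrightarrow> conn F y z \<Longrightarrow> conn F x z"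
  by (auto simp: conn_def)

lemma conn_sym: "conn F x y \<Longrightarrow> conn F y x"
proof -
  have "sym {(u, v). {u, v} \<in> F}"
    by (auto simp: sym_def insert_commute)
  then show "conn F x y \<Longrightarrow> conn F y x"
    unfolding conn_def by (meson sym_rtrancl symD)
qed

lemma conn_via: "conn F k x \<Longrightarrow> conn F k y \<Longrightarrow> conn F x y"
  by (rule conn_trans[OF conn_sym])

lemma conn_induct [consumes 1, case_names base step]:
  assumes "conn F x y" "P x"
    and "\<And>y z. conn F x y \<Longrightarrow> P y \<Longrightarrow> {y, z} \<in> F \<Longrightarrow> P z"
  shows "P y"
  using assms(1) unfolding conn_def
  by (induction rule: rtrancl_induct) (use assms(2,3) in \<open>auto simp: conn_def\<close>)

lemma conn_subst:
  assumes "conn F x y" "\<And>u v. {u, v} \<in> F \<Longrightarrow> conn F' u v"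
  shows "conn F' x y"
  using assms(1) by (induction rule: conn_induct) (auto intro: conn_trans assms(2))

lemma conn_mono: "conn F x y \<Longrightarrow> F \<subseteq> F' \<Longrightarrow> conn F' x y"
  by (erule conn_subst) (auto intro: conn_edge)

text \<open>A walk becomes a simple path edge by edge: when the next vertex already lies on the
  path, the path is cut back to it.\<close>

lemma conn_imp_path:
  assumes "conn F x y"
  shows "\<exists>p. is_path F x y p"
  using assms
proof (induction rule: conn_induct)
  case base
  have "is_path F x x [x]" by (simp add: is_path_def)
  then show ?case ..
next
  case (step y z)
  then obtain p where p: "is_path F x y p" by blast
  show ?case
  proof (cases "z \<in> set p")
    case True
    then obtain p1 p2 where p12: "p = (p1 @ [z]) @ p2" by (auto simp: in_set_conv_decomp)
    have "successively (\<lambda>x y. {x, y} \<in> F) (p1 @ [z])"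
      using p successively_append_iff unfolding is_path_def p12 by blast
    moreover have "hd (p1 @ [z]) = x" using p by (cases p1) (auto simp: is_path_def p12)
    ultimately have "is_path F x z (p1 @ [z])"
      using p by (auto simp: is_path_def p12)
    then show ?thesis ..
  next
    case False
    have "is_path F x z (p @ [z])"
      using p False step unfolding is_path_def
      by (simp add: successively_append_iff)
    then show ?thesis ..
  qed
qed

lemma successively_imp_conn:
  assumes "successively (\<lambda>x y. {x, y} \<in> F) p" "p \<noteq> []"
  shows "conn F (hd p) (last p)"
  using assms
proof (induction p rule: induct_list012)
  case (3 x y zs)
  then have "conn F x y" "conn F y (last (y # zs))" by (auto intro: conn_edge)
  then show ?case using conn_trans[of F x y "last (y # zs)"] by simp
qed auto

lemma path_imp_conn: "is_path F x y p \<Longrightarrow> conn F x y"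
  using successively_imp_conn[of F p] by (auto simp: is_path_def)

text \<open>The rest of a cycle bypasses its closing edge, which is therefore no bridge. Length at
  least three makes the other edges differ from the closing one.\<close>

lemma bridges_imp_acyclic:
  assumes "\<And>u v. {u, v} \<in> F \<Longrightarrow> \<not> conn (F - {{u, v}}) u v"
  shows "\<not> is_cycle F p"
proof
  assume cyc: "is_cycle F p"
  then obtain x y q where p: "p = x # y # q" and q: "q \<noteq> []"
    by (auto simp: is_cycle_def Suc_le_length_iff numeral_eq_Suc)
  have d: "distinct p" and s: "successively (\<lambda>x y. {x, y} \<in> F) p" and e: "{last p, hd p} \<in> F"
    using cyc by (auto simp: is_cycle_def)
  let ?F = "F - {{last p, hd p}}"
  have lq: "last p \<in> set q" "last p \<noteq> x" "last p \<noteq> y" using d q by (auto simp: p)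
  have "successively (\<lambda>x y. {x, y} \<in> ?F) (y # q)"
    by (rule successively_mono[of "\<lambda>x y. {x, y} \<in> F"])
      (use s d q in \<open>auto simp: p doubleton_eq_iff\<close>)
  then have "conn ?F y (last p)"
    using successively_imp_conn[of ?F "y # q"] q by (auto simp: p)
  moreover have "conn ?F x y"
    by (rule conn_edge) (use s lq d in \<open>auto simp: p doubleton_eq_iff\<close>)
  ultimately have "conn ?F x (last p)"
    by (rule conn_trans[rotated])
  then have "conn ?F (last p) (hd p)"
    using conn_sym by (fastforce simp: p)
  then show False using assms[OF e] by simp
qed

text \<open>The first edge of a walk that leaves \<open>v\<close> for good.\<close>

lemma conn_first_edge:
  assumes "conn F a v" "a \<noteq> v"
  shows "\<exists>z. {v, z} \<in> F \<and> conn {f \<in> F. v \<notin> f} a z"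
proof -
  let ?F = "{f \<in> F. v \<notin> f}"
  have "(y \<noteq> v \<and> conn ?F a y) \<or> (\<exists>z. {v, z} \<in> F \<and> conn ?F a z)" if "conn F a y" for y
    using that
  proof (induction rule: conn_induct)
    case base
    then show ?case using assms(2) by simp
  next
    case (step y z)
    then consider "y \<noteq> v" "conn ?F a y" "z \<noteq> v" | "conn ?F a y" "z = v"
      | "\<exists>z. {v, z} \<in> F \<and> conn ?F a z" by blast
    then show ?case
    proof cases
      case 1
      then have "{y, z} \<in> ?F" using step by auto
      then show ?thesis using 1 conn_trans[OF 1(2) conn_edge] by simp
    next
      case 2
      then show ?thesis using step(2) by (auto simp: insert_commute)
    qed auto
  qed
  then show ?thesis using assms by blast
qed

section \<open>Minimum-cost full components\<close>

locale steiner =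
  fixes V :: "'a set" and E R c
  assumes inst: "steiner_instance V E R c" and pre: "preprocessed V E R c"
begin

lemma finite_E: "finite E"
proof -
  have "E \<subseteq> Pow V" "finite V" using inst by (auto simp: steiner_instance_def simple_graph_def)
  then show ?thesis by (meson finite_Pow_iff finite_subset)
qed

lemma finite_R: "finite R"
  using inst by (auto simp: steiner_instance_def simple_graph_def intro: finite_subset)

lemma cost_nonneg: "f \<in> E \<Longrightarrow> 0 \<le> c f"
  using inst by (auto simp: steiner_instance_def)

lemma edgeE:
  assumes "f \<in> E"
  obtains u v where "f = {u, v}" "u \<noteq> v" "u \<in> V" "v \<in> V"
proof -
  have "card f = 2" "f \<subseteq> V" using inst assms by (auto simp: steiner_instance_def simple_graph_def)
  then show ?thesis using that by (auto simp: card_2_iff)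
qed

lemma edge_memE:
  assumes "f \<in> E" "u \<in> f"
  obtains v where "f = {u, v}" "u \<noteq> v"
  using assms by (metis edgeE insert_commute insertE singletonD)

lemma edge_neq: "{u, v} \<in> E \<Longrightarrow> u \<noteq> v"
  by (metis doubleton_eq_iff edgeE)

lemma path2_cost: "path_cost c [a, v, b] = c {a, v} + c {v, b}"
  by (simp add: path_cost_def)

lemma shortest_edge_le2:
  assumes "shortest_edge E c a b" "{a, v} \<in> E" "{v, b} \<in> E" "a \<noteq> b"
  shows "{a, b} \<in> E" "c {a, b} \<le> c {a, v} + c {v, b}"
proof -
  have "is_path E a b [a, v, b]"
    using assms edge_neq by (auto simp: is_path_def)
  then show "{a, b} \<in> E" "c {a, b} \<le> c {a, v} + c {v, b}"
    using assms(1) unfolding shortest_edge_def is_shortest_path_def path2_cost[symmetric] by auto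
qed

text \<open>Preprocessing grants distances only to pairs containing a terminal and to pairs within
  one Steiner neighborhood. Two Steiner ends \<open>a\<close> and \<open>b\<close> are of the second
  kind because the Steiner vertex \<open>v\<close> joins them.\<close>

lemma shortcut:
  assumes v: "v \<notin> R" and e: "{a, v} \<in> E" "{v, b} \<in> E" and ab: "a \<noteq> b"
  shows "{a, b} \<in> E \<and> c {a, b} \<le> c {a, v} + c {v, b}"
proof -
  have vs: "a \<in> V" "b \<in> V" "v \<in> V"
    using e by (metis edgeE insertCI insertE singletonD)+
  consider "b \<notin> R" "a \<in> R" | "a \<in> R" "b \<in> R" | "a \<notin> R" "b \<in> R" | "a \<notin> R" "b \<notin> R" by blast
  then have "shortest_edge E c a b \<or> shortest_edge E c b a"
  proof cases
    case 4
    have "is_path {e \<in> E. e \<subseteq> V - R} b a [b, v, a]"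
      using e 4 vs v ab edge_neq by (auto simp: is_path_def insert_commute)
    then have "a \<in> steiner_nbhd V E R b"
      using 4 vs by (auto simp: steiner_nbhd_def)
    then show ?thesis using pre 4 vs ab by (auto simp: preprocessed_def)
  qed (use pre vs ab in \<open>auto simp: preprocessed_def\<close>)
  then show ?thesis
    using shortest_edge_le2[of a b v] shortest_edge_le2[of b a v] e ab
    by (auto simp: insert_commute)
qed

text \<open>A full component with terminal set \<open>K\<close>, up to cycles and useless Steiner vertices.\<close>

definition semi_full :: "'a set \<Rightarrow> 'a set set \<Rightarrow> bool" where
  "semi_full K F \<longleftrightarrow> F \<subseteq> E \<and> \<Union>F \<inter> R \<subseteq> K \<and> (\<forall>k\<in>K. degree F k \<le> 1) \<and>
     (\<forall>k\<in>K. \<forall>l\<in>K. conn F k l)"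

text \<open>Costs may be zero, so a cheapest set may still contain cycles and Steiner vertices of
  low degree; the tie-break on the number of edges removes them.\<close>

definition optimal :: "'a set \<Rightarrow> 'a set set \<Rightarrow> bool" where
  "optimal K F \<longleftrightarrow> semi_full K F \<and>
     (\<forall>F'. semi_full K F' \<longrightarrow> sum c F < sum c F' \<or> sum c F = sum c F' \<and> card F \<le> card F')"

lemma optimal_exists:
  assumes "semi_full K F0"
  shows "\<exists>F. optimal K F"
proof -
  let ?S = "{F. semi_full K F}"
  have "?S \<subseteq> Pow E" by (auto simp: semi_full_def)
  then have fin: "finite ?S" using finite_E by (meson finite_Pow_iff finite_subset)
  let ?m = "Min (sum c ` ?S)"
  have "?m \<in> sum c ` ?S" using fin assms by (intro Min_in) auto
  then obtain F1 where F1: "semi_full K F1" "sum c F1 = ?m" by auto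
  then obtain F where F: "semi_full K F \<and> sum c F = ?m"
    and least: "\<And>F'. semi_full K F' \<and> sum c F' = ?m \<Longrightarrow> card F \<le> card F'"
    using ex_has_least_nat[of "\<lambda>F. semi_full K F \<and> sum c F = ?m" F1 card] by blast
  have "?m \<le> sum c F'" if "semi_full K F'" for F'
    using fin that by (intro Min_le) auto
  then have "optimal K F"
    using F least unfolding optimal_def by (metis order_le_less)
  then show ?thesis ..
qed

lemma finite_sub: "F \<subseteq> E \<Longrightarrow> finite F"
  using finite_E finite_subset by blast

lemma sum_mono_E: "F \<subseteq> G \<Longrightarrow> G \<subseteq> E \<Longrightarrow> sum c F \<le> sum c G"
  by (rule sum_mono2) (use finite_sub cost_nonneg in auto)

lemma optimal_no_improve:
  assumes "optimal K F" "semi_full K F'" "sum c F' \<le> sum c F"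
  shows "card F \<le> card F'"
  using assms unfolding optimal_def by force

lemma degree_mono: "F \<subseteq> G \<Longrightarrow> finite G \<Longrightarrow> degree F v \<le> degree G v"
  unfolding degree_def by (rule card_mono) auto

section \<open>Structure of optimal edge sets\<close>

context
  fixes K F
  assumes opt: "optimal K F" and K: "K \<subseteq> R" "2 \<le> card K"
begin

lemma opt_semi_full: "semi_full K F" and opt_sub: "F \<subseteq> E" and opt_finite: "finite F"
  using opt finite_sub by (auto simp: optimal_def semi_full_def)

lemma opt_conn: "k \<in> K \<Longrightarrow> l \<in> K \<Longrightarrow> conn F k l"
  using opt_semi_full by (auto simp: semi_full_def)

lemma opt_minimal:
  assumes "f \<in> F" shows "\<exists>k\<in>K. \<exists>l\<in>K. \<not> conn (F - {f}) k l"
proof (rule ccontr)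
  assume "\<not> ?thesis"
  then have "semi_full K (F - {f})"
    using opt_semi_full degree_mono[of "F - {f}" F] opt_finite
    unfolding semi_full_def by (meson Diff_subset Union_mono Int_mono order_refl order_trans)
  then have "card F \<le> card (F - {f})"
    using optimal_no_improve[OF opt] sum_mono_E[of "F - {f}" F] opt_sub by blast
  then show False using assms opt_finite by (metis card_Diff1_less not_less)
qed

text \<open>Walks through the edge could be rerouted along the detour, so all terminals would stay
  connected without it, contrary to minimality.\<close>

lemma opt_bridge:
  assumes "{u, v} \<in> F" shows "\<not> conn (F - {{u, v}}) u v"
proof
  assume c: "conn (F - {{u, v}}) u v"
  have "conn (F - {{u, v}}) k l" if "k \<in> K" "l \<in> K" for k l
  proof (rule conn_subst[OF opt_conn[OF that]])
    fix x y assume xy: "{x, y} \<in> F"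
    show "conn (F - {{u, v}}) x y"
    proof (cases "{x, y} = {u, v}")
      case True
      then show ?thesis using c conn_sym by (auto simp: doubleton_eq_iff)
    next
      case False
      then show ?thesis using xy by (intro conn_edge) auto
    qed
  qed
  then show False using opt_minimal[OF assms] by blast
qed

text \<open>An edge outside the connected component of the terminals is avoided by every walk
  between them and could be deleted.\<close>

lemma opt_conn_all:
  assumes x: "x \<in> \<Union>F" and k: "k \<in> K" shows "conn F k x"
proof (rule ccontr)
  assume no: "\<not> conn F k x"
  obtain f where f: "f \<in> F" "x \<in> f" using x by blast
  obtain y where y: "f = {x, y}" using edge_memE f opt_sub by (metis subsetD)
  have nf: "\<not> conn F k x" "\<not> conn F k y"
    using no f(1) conn_trans[of F k y x] conn_edge[of y x F] by (auto simp: y insert_commute)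
  have "conn (F - {f}) k z" if "conn F k z" for z
    using that
  proof (induction rule: conn_induct)
    case (step z w)
    have "{z, w} \<noteq> f" using nf step(1) by (auto simp: y doubleton_eq_iff)
    then have "conn (F - {f}) z w" using step by (intro conn_edge) auto
    then show ?case using step conn_trans[of "F - {f}" k z w] by blast
  qed simp
  then have "conn (F - {f}) l m" if "l \<in> K" "m \<in> K" for l m
    using conn_via[of "F - {f}" k l m] that opt_conn[OF k] by blast
  then show False using opt_minimal[OF f(1)] by blast
qed

lemma opt_term_cover: "k \<in> K \<Longrightarrow> \<exists>f\<in>F. k \<in> f"
proof -
  assume k: "k \<in> K"
  have "\<not> K \<subseteq> {k}" using K(2) card_mono[of "{k}" K] by auto
  then obtain l where l: "l \<in> K" "l \<noteq> k" by blast
  then show ?thesis using conn_first_edge[OF opt_conn[OF l(1) k]] by blast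
qed

lemma opt_terms: "\<Union>F \<inter> R = K"
  using opt_semi_full opt_term_cover K by (auto simp: semi_full_def)

lemma opt_degree_term: "k \<in> K \<Longrightarrow> degree F k = 1"
proof -
  assume k: "k \<in> K"
  have "degree F k \<le> 1" using opt_semi_full k by (auto simp: semi_full_def)
  moreover have "degree F k \<noteq> 0" using opt_term_cover[OF k] opt_finite by (auto simp: degree_def)
  ultimately show ?thesis by simp
qed

text \<open>A Steiner leaf can be cut off, and a Steiner vertex of degree two can be bypassed by a
  shortcut edge. Either way the number of edges drops while the cost does not rise.\<close>

lemma opt_degree_steiner:
  assumes v: "v \<in> \<Union>F - R" shows "3 \<le> degree F v"
proof (rule ccontr)
  assume "\<not> 3 \<le> degree F v"
  moreover have "degree F v \<noteq> 0" using v opt_finite by (auto simp: degree_def)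
  ultimately consider "degree F v = 1" | "degree F v = 2" by linarith
  then show False
  proof cases
    case 1
    then obtain f where f: "{e \<in> F. v \<in> e} = {f}" by (auto simp: degree_def card_1_singleton_iff)
    then have fF: "f \<in> F" "v \<in> f" by auto
    have sub: "{e \<in> F. v \<notin> e} \<subseteq> F - {f}" using fF by auto
    have "conn (F - {f}) k l" if "k \<in> K" "l \<in> K" for k l
    proof -
      have kv: "k \<noteq> v" and lv: "l \<noteq> v" using that v K by auto
      have ex: "\<exists>z. {v, z} \<in> F \<and> conn (F - {f}) m z" if "m \<in> K" for m
      proof -
        have "m \<noteq> v" "conn F m v" using that v K opt_conn_all by auto
        then obtain z where "{v, z} \<in> F" "conn {e \<in> F. v \<notin> e} m z"
          using conn_first_edge by metis
        then show ?thesis using conn_mono[OF _ sub] by blast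
      qed
      obtain z1 z2 where z: "{v, z1} \<in> F" "conn (F - {f}) k z1" "{v, z2} \<in> F" "conn (F - {f}) l z2"
        using ex[OF \<open>k \<in> K\<close>] ex[OF \<open>l \<in> K\<close>] by blast
      have "{v, z1} \<in> {e \<in> F. v \<in> e}" "{v, z2} \<in> {e \<in> F. v \<in> e}" using z by simp_all
      then have "{v, z1} = f" "{v, z2} = f" unfolding f by simp_all
      then have "z1 = z2" by (auto simp: doubleton_eq_iff)
      then show ?thesis using z by (auto intro: conn_trans[OF _ conn_sym])
    qed
    then show False using opt_minimal[OF fF(1)] by blast
  next
    case 2
    then obtain f g where fg: "{e \<in> F. v \<in> e} = {f, g}" "f \<noteq> g"
      by (auto simp: degree_def card_2_iff)
    then have fF: "f \<in> F" "v \<in> f" "g \<in> F" "v \<in> g" by auto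
    obtain a where a: "f = {v, a}" "v \<noteq> a" using edge_memE fF opt_sub by (metis subsetD)
    obtain a' where a': "g = {v, a'}" "v \<noteq> a'" using edge_memE fF opt_sub by (metis subsetD)
    have ne: "a \<noteq> a'" using fg a a' by auto
    let ?h = "{a, a'}"
    let ?F = "insert ?h (F - {f, g})"
    have sc: "?h \<in> E" "c ?h \<le> c f + c g"
      using shortcut[of v a a'] v a a' fF opt_sub ne by (auto simp: insert_commute)
    have F'E: "?F \<subseteq> E" using sc opt_sub by auto
    have cF: "sum c F = sum c (F - {f, g}) + c f + c g"
    proof -
      have "F = insert f (insert g (F - {f, g}))" using fF by auto
      then have "sum c F = sum c (insert f (insert g (F - {f, g})))" by simp
      then show ?thesis using fg(2) opt_finite by simp
    qed
    \<comment> \<open>The shortcut edge may already belong to \<open>F\<close>, so cost and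
      cardinality are only bounded.\<close>
    have "sum c ?F \<le> c ?h + sum c (F - {f, g})"
      using opt_finite cost_nonneg[OF sc(1)] by (simp add: sum.insert_if)
    then have cost: "sum c ?F \<le> sum c F" using cF sc by simp
    have cardF: "card F = Suc (Suc (card (F - {f, g})))"
    proof -
      have "F = insert f (insert g (F - {f, g}))" using fF by auto
      then have "card F = card (insert f (insert g (F - {f, g})))" by simp
      then show ?thesis using fg(2) opt_finite by simp
    qed
    have "card ?F \<le> Suc (card (F - {f, g}))" by (rule card_insert_le_m1) auto
    then have less: "card ?F < card F" using cardF by simp
    have deg: "degree ?F k \<le> 1" if k: "k \<in> K" for k
    proof -
      have kF: "card {e \<in> F. k \<in> e} = 1" using opt_degree_term[OF k] by (simp add: degree_def)
      have kv: "k \<noteq> v" using k K v by auto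
      show ?thesis
      proof (cases "k \<in> ?h")
        case False
        then have "{e \<in> ?F. k \<in> e} \<subseteq> {e \<in> F. k \<in> e}" by auto
        then have "card {e \<in> ?F. k \<in> e} \<le> card {e \<in> F. k \<in> e}"
          by (rule card_mono[rotated]) (use opt_finite in auto)
        then show ?thesis unfolding degree_def using kF by simp
      next
        case True
        \<comment> \<open>The only edge at \<open>k\<close> is \<open>f\<close> or \<open>g\<close>;
          both are gone, and the shortcut takes its place.\<close>
        then obtain e where e: "e \<in> {f, g}" "k \<in> e" "e \<in> F" using a a' fF by auto
        obtain e' where "{e \<in> F. k \<in> e} = {e'}" using kF card_1_singletonE by metis
        then have "{e \<in> F. k \<in> e} = {e}" using e by auto
        then have "{e \<in> ?F. k \<in> e} \<subseteq> {?h}" using e by auto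
        then have "card {e \<in> ?F. k \<in> e} \<le> card {?h}"
          by (rule card_mono[rotated]) auto
        then show ?thesis unfolding degree_def by simp
      qed
    qed
    have conn': "conn ?F k l" if k: "k \<in> K" and l: "l \<in> K" for k l
    proof -
      have lv: "l \<noteq> v" "k \<noteq> v" using l k K v by auto
      have h: "conn ?F a a'" "conn ?F a' a" by (auto intro!: conn_edge simp: insert_commute)
      \<comment> \<open>The new edge set no longer touches \<open>v\<close>; a walk standing at
        \<open>v\<close> is represented by \<open>a\<close>, from which the shortcut leads to
        \<open>a'\<close>.\<close>
      have "(y \<noteq> v \<longrightarrow> conn ?F k y) \<and> (y = v \<longrightarrow> conn ?F k a)" if "conn F k y" for y
        using that
      proof (induction rule: conn_induct)
        case base
        then show ?case using lv by simp
      next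
        case (step y z)
        have yz: "{y, z} \<in> F" using step by blast
        have e: "w = a \<or> w = a'" if "{v, w} \<in> F" for w
        proof -
          have "{v, w} \<in> {e \<in> F. v \<in> e}" using that by simp
          then have "{v, w} \<in> {f, g}" unfolding fg(1) .
          then show ?thesis using a a' by (auto simp: doubleton_eq_iff)
        qed
        consider "y = v" "z = v" | "y = v" "z \<noteq> v" | "y \<noteq> v" "z = v" | "y \<noteq> v" "z \<noteq> v" by blast
        then show ?case
        proof cases
          case 2
          then have "z = a \<or> z = a'" "conn ?F k a" using e yz step by auto
          then show ?thesis using 2 h conn_trans[of ?F k a a'] by auto
        next
          case 3
          then have "y = a \<or> y = a'" "conn ?F k y" using e yz step by (auto simp: insert_commute)
          then show ?thesis using 3 h conn_trans[of ?F k a' a] by auto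
        next
          case 4
          then have "{y, z} \<in> ?F" using yz a a' by auto
          then have "conn ?F y z" by (rule conn_edge)
          then show ?thesis using 4 step conn_trans[of ?F k y z] by auto
        qed (use step in auto)
      qed
      then show ?thesis using opt_conn[OF k l] lv by blast
    qed
    have "\<Union>?F \<subseteq> \<Union>F" using a a' fF by auto
    then have "\<Union>?F \<inter> R \<subseteq> K" using opt_terms by blast
    then have "semi_full K ?F"
      unfolding semi_full_def using F'E deg conn' by (intro conjI ballI)
    then have "card F \<le> card ?F" using optimal_no_improve[OF opt] cost by blast
    then show False using less by simp
  qed
qed

lemma opt_full_component: "full_component V E R K (\<Union>F) F"
proof -
  have ne: "\<Union>F \<noteq> {}" using opt_terms K by fastforce
  have sub: "\<Union>F \<subseteq> V" using opt_sub inst by (auto simp: steiner_instance_def simple_graph_def)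
  have "simple_graph (\<Union>F) F"
    using inst opt_sub sub by (auto simp: steiner_instance_def simple_graph_def intro: finite_subset)
  moreover have "\<exists>p. is_path F u v p" if "u \<in> \<Union>F" "v \<in> \<Union>F" for u v
  proof -
    obtain k where "k \<in> K" using K by fastforce
    then have "conn F u v" using conn_via[OF opt_conn_all opt_conn_all] that by blast
    then show ?thesis by (rule conn_imp_path)
  qed
  moreover have "\<not> is_cycle F p" for p by (rule bridges_imp_acyclic[OF opt_bridge])
  ultimately have tree: "is_tree (\<Union>F) F" using ne by (simp add: is_tree_def)
  have "if degree F v = 1 then v \<in> R else v \<in> V - R" if "v \<in> \<Union>F" for v
    using that opt_degree_term[of v] opt_degree_steiner[of v] opt_terms sub by (cases "v \<in> R") auto
  then show ?thesis using tree sub opt_sub opt_terms unfolding full_component_def by blast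
qed

end

lemma full_component_semi_full:
  assumes "full_component V E R K VT ET"
  shows "semi_full K ET"
proof -
  have fc: "ET \<subseteq> E" "K = VT \<inter> R" "is_tree VT ET" and
    deg: "\<forall>v\<in>VT. if degree ET v = 1 then v \<in> R else v \<in> V - R"
    using assms by (auto simp: full_component_def)
  have "\<Union>ET \<subseteq> VT" using fc(3) by (auto simp: is_tree_def simple_graph_def)
  moreover have "degree ET k \<le> 1" if "k \<in> K" for k
    using deg that fc(2) by (metis DiffD2 IntD1 IntD2 order_refl)
  moreover have "conn ET k l" if "k \<in> K" "l \<in> K" for k l
  proof -
    obtain p where "is_path ET k l p"
      using fc(2,3) \<open>k \<in> K\<close> \<open>l \<in> K\<close> unfolding is_tree_def by blast
    then show ?thesis by (rule path_imp_conn)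
  qed
  ultimately show ?thesis using fc by (auto simp: semi_full_def)
qed

text \<open>Full components are among the sets that \<open>optimal\<close> minimizes over, and an
  optimal set is itself a full component, so the relaxed minimum is attained by a genuine
  one.\<close>

lemma optimal_comp_cost:
  assumes opt: "optimal K F" and K: "K \<subseteq> R" "2 \<le> card K"
  shows "comp_cost V E R c K = sum c F"
  unfolding comp_cost_def
proof (rule Min_eqI)
  have "{\<Sum>e\<in>ET. c e |VT ET. full_component V E R K VT ET} \<subseteq> sum c ` Pow E"
    by (auto simp: full_component_def)
  then show "finite {\<Sum>e\<in>ET. c e |VT ET. full_component V E R K VT ET}"
    using finite_E by (meson finite_Pow_iff finite_imageI finite_subset)
next
  fix y assume "y \<in> {\<Sum>e\<in>ET. c e |VT ET. full_component V E R K VT ET}"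
  then show "sum c F \<le> y"
    using full_component_semi_full opt by (force simp: optimal_def)
next
  show "sum c F \<in> {\<Sum>e\<in>ET. c e |VT ET. full_component V E R K VT ET}"
    using opt_full_component[OF assms] by blast
qed

text \<open>Upper bounds on \<open>comp_cost\<close> thus need only a connecting edge set whose
  terminals have degree at most one, not a tree.\<close>

lemma semi_full_comp:
  assumes "semi_full K F" "K \<subseteq> R" "2 \<le> card K" "card K \<le> r"
  shows "K \<in> full_comps r V E R" "comp_cost V E R c K \<le> sum c F"
proof -
  obtain F' where F': "optimal K F'" using optimal_exists assms(1) by blast
  show "K \<in> full_comps r V E R"
    using opt_full_component[OF F' assms(2,3)] assms by (auto simp: full_comps_def)
  show "comp_cost V E R c K \<le> sum c F"
    using optimal_comp_cost[OF F' assms(2,3)] F' assms(1) by (force simp: optimal_def)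
qed

lemma full_comps_optimal:
  assumes "K \<in> full_comps r V E R"
  obtains F where "optimal K F" "K \<subseteq> R" "2 \<le> card K" "card K \<le> r" "comp_cost V E R c K = sum c F"
proof -
  have K: "K \<subseteq> R" "2 \<le> card K" "card K \<le> r" using assms by (auto simp: full_comps_def)
  obtain VT ET where "full_component V E R K VT ET" using assms by (auto simp: full_comps_def)
  then obtain F where "optimal K F" using optimal_exists full_component_semi_full by blast
  then show ?thesis using that K optimal_comp_cost by blast
qed

section \<open>Splitting a component and its loss\<close>

text \<open>Without \<open>D\<close> the terminals fall into classes of \<open>conn\<close>. A class
  with at least two terminals, together with the edges it reaches, gives a component. Distinct
  classes reach disjoint edge sets, so the costs add up within \<open>F - D\<close>. A class with
  one terminal gives no component, whence the alternative \<open>k = l\<close>.\<close>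

lemma split_component:
  assumes opt: "optimal K F" and K: "K \<subseteq> R" "card K \<le> r"
  shows "\<exists>\<G>. finite \<G> \<and> \<G> \<subseteq> full_comps r V E R \<and>
    sum (comp_cost V E R c) \<G> \<le> sum c (F - D) \<and>
    (\<forall>k\<in>K. \<forall>l\<in>K. conn (F - D) k l \<longrightarrow> k = l \<or> (\<exists>G\<in>\<G>. k \<in> G \<and> l \<in> G))"
proof -
  have sf: "semi_full K F" using opt by (simp add: optimal_def)
  then have FE: "F \<subseteq> E" and FK: "\<Union>F \<inter> R \<subseteq> K" by (auto simp: semi_full_def)
  have finF: "finite F" using FE by (rule finite_sub)
  have finK: "finite K" using K finite_R finite_subset by blast
  let ?H = "F - D"
  define cls where "cls k = {l \<in> K. conn ?H k l}" for k
  define \<G> where "\<G> = {G \<in> cls ` K. 2 \<le> card G}"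
  define FG where "FG G = {f \<in> ?H. \<exists>x\<in>f. \<exists>k\<in>G. conn ?H k x}" for G
  have FG_conn: "conn ?H k x" if "k \<in> K" and f: "f \<in> FG (cls k)" and "x \<in> f" for k f x
  proof -
    obtain y l where yl: "f \<in> ?H" "y \<in> f" "conn ?H k l" "conn ?H l y"
      using f unfolding FG_def cls_def by blast
    obtain z where z: "f = {y, z}" using edge_memE yl FE by (metis DiffD1 subsetD)
    have "conn ?H y x" using z that(3) yl(1) by (auto intro: conn_edge)
    then show ?thesis using conn_trans[OF conn_trans[OF yl(3,4)]] by simp
  qed
  have cls_semi: "semi_full (cls k) (FG (cls k))" if k: "k \<in> K" for k
    unfolding semi_full_def
  proof (intro conjI ballI)
    show "FG (cls k) \<subseteq> E" using FE by (auto simp: FG_def)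
    show "\<Union>(FG (cls k)) \<inter> R \<subseteq> cls k"
      using FG_conn[OF k] FK by (fastforce simp: cls_def FG_def)
  next
    fix l assume "l \<in> cls k"
    then have "degree F l \<le> 1" using sf by (auto simp: semi_full_def cls_def)
    moreover have "degree (FG (cls k)) l \<le> degree F l"
      by (rule degree_mono) (use finF in \<open>auto simp: FG_def\<close>)
    ultimately show "degree (FG (cls k)) l \<le> 1" by simp
  next
    have *: "conn (FG (cls k)) k y" if "conn ?H k y" for y
      using that
    proof (induction rule: conn_induct)
      case (step y z)
      have "{y, z} \<in> FG (cls k)" using step k by (auto simp: FG_def cls_def)
      then show ?case using conn_trans[OF step.IH conn_edge] by blast
    qed simp
    fix l m assume "l \<in> cls k" "m \<in> cls k"
    then show "conn (FG (cls k)) l m" using conn_via[OF * *] by (auto simp: cls_def)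
  qed
  have cls_sub: "cls k \<subseteq> K" for k by (auto simp: cls_def)
  have G: "semi_full G (FG G)" "G \<subseteq> R" "2 \<le> card G" "card G \<le> r" if G: "G \<in> \<G>" for G
  proof -
    obtain k where k: "k \<in> K" "G = cls k" using G by (auto simp: \<G>_def)
    show "semi_full G (FG G)" "G \<subseteq> R" "2 \<le> card G" "card G \<le> r"
      using k cls_semi[OF k(1)] cls_sub[of k] K that card_mono[OF finK cls_sub]
      by (auto simp: \<G>_def intro: order_trans)
  qed
  have finG: "finite \<G>" using finK by (auto simp: \<G>_def)
  have "sum (comp_cost V E R c) \<G> \<le> (\<Sum>G\<in>\<G>. sum c (FG G))"
    by (rule sum_mono) (rule semi_full_comp(2)[OF G])
  also have "\<dots> = sum c (\<Union>(FG ` \<G>))"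
  proof (rule sum.UNION_disjoint[symmetric])
    show "\<forall>G\<in>\<G>. finite (FG G)" using finF by (auto simp: FG_def)
    show "\<forall>G\<in>\<G>. \<forall>G'\<in>\<G>. G \<noteq> G' \<longrightarrow> FG G \<inter> FG G' = {}"
    proof (intro ballI impI, rule ccontr)
      fix G G' assume GG: "G \<in> \<G>" "G' \<in> \<G>" "G \<noteq> G'" "FG G \<inter> FG G' \<noteq> {}"
      obtain k k' where k: "k \<in> K" "G = cls k" "k' \<in> K" "G' = cls k'" using GG by (auto simp: \<G>_def)
      obtain f where f: "f \<in> FG G" "f \<in> FG G'" using GG by blast
      obtain x where x: "x \<in> f" using f by (auto simp: FG_def)
      have "conn ?H k x" "conn ?H k' x" using FG_conn k f x by blast+
      then have "conn ?H k k'" "conn ?H k' k"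
        using conn_trans[OF _ conn_sym, of ?H _ x] by blast+
      then have "cls k = cls k'" using conn_trans[of ?H k k'] conn_trans[of ?H k' k]
        by (auto simp: cls_def)
      then show False using GG k by simp
    qed
  qed (rule finG)
  also have "\<dots> \<le> sum c ?H"
    by (rule sum_mono_E) (use FE in \<open>auto simp: FG_def\<close>)
  finally have cost: "sum (comp_cost V E R c) \<G> \<le> sum c ?H" .
  have "k = l \<or> (\<exists>G\<in>\<G>. k \<in> G \<and> l \<in> G)" if kl: "k \<in> K" "l \<in> K" "conn ?H k l" for k l
  proof (rule disjCI)
    assume "\<not> (\<exists>G\<in>\<G>. k \<in> G \<and> l \<in> G)"
    moreover have "k \<in> cls k" "l \<in> cls k" using kl by (auto simp: cls_def)
    ultimately have "\<not> 2 \<le> card (cls k)" using kl(1) by (auto simp: \<G>_def)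
    then have "card (cls k) \<le> Suc 0" by simp
    then show "k = l"
      using \<open>k \<in> cls k\<close> \<open>l \<in> cls k\<close> card_le_Suc0_iff_eq[OF finite_subset[OF cls_sub finK]] by blast
  qed
  then show ?thesis
    using cost finG semi_full_comp(1)[OF G] by (intro exI[of _ \<G>]) auto
qed

section \<open>The loss of an optimal component\<close>

context
  fixes K F b
  assumes opt: "optimal K F" and K: "K \<subseteq> R" "2 \<le> card K" and qb: "quasi_bipartite b V E R"
begin

text \<open>Terminals are leaves, so between Steiner vertices no walk gains anything by visiting
  one. All Steiner vertices of \<open>F\<close> thus lie in a single Steiner neighborhood.\<close>

lemma card_steiner_le: "card (\<Union>F - R) \<le> b"
proof (cases "\<Union>F - R = {}")
  case False
  then obtain v where v: "v \<in> \<Union>F" "v \<notin> R" by blast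
  note F = opt_sub[OF opt K] opt_finite[OF opt K] opt_terms[OF opt K] opt_degree_term[OF opt K]
  have FV: "\<Union>F \<subseteq> V" using F(1) inst by (auto simp: steiner_instance_def simple_graph_def)
  let ?E = "{e \<in> E. e \<subseteq> V - R}"
  have nbr: "w = y" if "{y, t} \<in> F" "{t, w} \<in> F" "t \<in> R" for y t w
  proof -
    have "t \<in> K" using that F(3) by auto
    then have "card {e \<in> F. t \<in> e} = 1" using F(4) by (simp add: degree_def)
    then obtain e where e: "{e \<in> F. t \<in> e} = {e}" by (metis card_1_singletonE)
    have "{y, t} \<in> {e \<in> F. t \<in> e}" "{t, w} \<in> {e \<in> F. t \<in> e}" using that by auto
    then show ?thesis unfolding e by (auto simp: doubleton_eq_iff)
  qed
  \<comment> \<open>At a terminal the invariant remembers its Steiner neighbor, to which the walk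
    must return.\<close>
  have main: "if y \<in> R then \<exists>z. z \<notin> R \<and> {z, y} \<in> F \<and> conn ?E v z else conn ?E v y" if "conn F v y" for y
    using that
  proof (induction rule: conn_induct)
    case base
    then show ?case using v by simp
  next
    case (step y z)
    have yz: "{y, z} \<in> F" using step by blast
    consider "y \<in> R" | "y \<notin> R" "z \<in> R" | "y \<notin> R" "z \<notin> R" by blast
    then show ?case
    proof cases
      case 1
      then obtain w where "w \<notin> R" "{w, y} \<in> F" "conn ?E v w" using step.IH by auto
      then show ?thesis using nbr[of w y z] yz 1 by auto
    next
      case 2
      then show ?thesis using step.IH yz by auto
    next
      case 3
      have "{y, z} \<in> ?E" using yz 3 F(1) FV by auto
      then have "conn ?E y z" by (rule conn_edge)
      then show ?thesis using 3 step.IH conn_trans[of ?E v y z] by simp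
    qed
  qed
  obtain k where k: "k \<in> K" using K by fastforce
  have "\<Union>F - R \<subseteq> steiner_nbhd V E R v"
  proof
    fix u assume u: "u \<in> \<Union>F - R"
    have "conn F v u"
      using conn_via[OF opt_conn_all[OF opt K v(1) k] opt_conn_all[OF opt K _ k]] u by blast
    then have "conn ?E v u" using main[of u] u by auto
    then show "u \<in> steiner_nbhd V E R v"
      using conn_imp_path u FV by (auto simp: steiner_nbhd_def)
  qed
  moreover have "finite (steiner_nbhd V E R v)"
    using inst by (auto simp: steiner_nbhd_def steiner_instance_def simple_graph_def)
  ultimately have "card (\<Union>F - R) \<le> card (steiner_nbhd V E R v)" by (rule card_mono[rotated])
  also have "\<dots> \<le> b" using qb v FV by (auto simp: quasi_bipartite_def)
  finally show ?thesis .
qed (simp only: card.empty)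

text \<open>
  The tree is rooted at a most expensive edge \<open>e\<close>, and each Steiner vertex picks a cheapest edge
  to a child. As there are at least two children, the picked edges cost at most half of what
  remains without \<open>e\<close>; as there are at most \<open>b\<close> picks, they cost at most \<open>b\<close> times as much as \<open>e\<close>.
\<close>

lemma loss_exists:
  "\<exists>L \<tau>. L \<subseteq> F \<and> (\<forall>x\<in>\<Union>F. \<tau> x \<in> K \<and> conn L x (\<tau> x)) \<and> (\<forall>k\<in>K. \<tau> k = k) \<and>
     (\<forall>x y. {x, y} \<in> L \<longrightarrow> \<tau> x = \<tau> y) \<and> (2 * real b + 1) * sum c L \<le> real b * sum c F"
proof -
  note FE = opt_sub[OF opt K] and finF = opt_finite[OF opt K] and terms = opt_terms[OF opt K]
    and bridge = opt_bridge[OF opt K]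
  have "\<Union>F \<subseteq> V" using FE inst by (auto simp: steiner_instance_def simple_graph_def)
  then have finUF: "finite (\<Union>F)"
    using inst finite_subset by (auto simp: steiner_instance_def simple_graph_def)
  have allconn: "conn F x y" if "x \<in> \<Union>F" "y \<in> \<Union>F" for x y
  proof -
    obtain k where k: "k \<in> K" using K by fastforce
    show ?thesis
      by (rule conn_via[OF opt_conn_all[OF opt K that(1) k] opt_conn_all[OF opt K that(2) k]])
  qed
  have neF: "F \<noteq> {}" using terms K by fastforce
  obtain e where e: "e \<in> F" and emax: "\<And>f. f \<in> F \<Longrightarrow> c f \<le> c e"
  proof -
    have "Max (c ` F) \<in> c ` F" using finF neF by (intro Max_in) auto
    then obtain e where "e \<in> F" "c e = Max (c ` F)" by auto
    then show ?thesis using that finF Max_ge[of "c ` F"] by auto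
  qed
  obtain a a' where a: "e = {a, a'}" using edgeE e FE by (metis subsetD)
  have aF: "a \<in> \<Union>F" using a e by auto
  \<comment> \<open>The edges leading from \<open>v\<close> away from the root edge: without
    \<open>f\<close>, \<open>v\<close> is still on the side of \<open>a\<close>. One end of
    \<open>e\<close> suffices as reference, since \<open>f \<noteq> e\<close> keeps both ends
    together.\<close>
  define ch where "ch v = {f \<in> F. v \<in> f \<and> f \<noteq> e \<and> conn (F - {f}) a v}" for v
  have finch: "finite (ch v)" for v using finF by (auto simp: ch_def)
  have ch2: "2 \<le> card (ch v)" if v: "v \<in> \<Union>F - R" for v
  proof -
    \<comment> \<open>At most one edge at \<open>v\<close> is no child edge: \<open>e\<close> itself
      if \<open>v\<close> is an end of \<open>e\<close>, otherwise the edge towards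
      \<open>a\<close>.\<close>
    have "\<exists>f0. {f \<in> F. v \<in> f} \<subseteq> insert f0 (ch v)"
    proof (cases "v \<in> e")
      case True
      have "f \<in> ch v" if f: "f \<in> F" "v \<in> f" "f \<noteq> e" for f
      proof -
        have "{a, a'} \<in> F - {f}" using e a f by auto
        then have "conn (F - {f}) a v" using True a by (auto intro: conn_edge)
        then show ?thesis using f by (auto simp: ch_def)
      qed
      then show ?thesis by blast
    next
      case False
      then have "a \<noteq> v" using a by auto
      then obtain z where z: "{v, z} \<in> F" "conn {f \<in> F. v \<notin> f} a z"
        using conn_first_edge[OF allconn[OF aF]] v by blast
      have "f \<in> ch v" if f: "f \<in> F" "v \<in> f" "f \<noteq> {v, z}" for f
      proof -
        have "conn (F - {f}) a z" by (rule conn_mono[OF z(2)]) (use f in auto)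
        moreover have "conn (F - {f}) z v"
          by (rule conn_edge) (use z f in \<open>auto simp: insert_commute\<close>)
        ultimately have "conn (F - {f}) a v" by (rule conn_trans)
        then show ?thesis using f False by (auto simp: ch_def)
      qed
      then show ?thesis by blast
    qed
    then obtain f0 where f0: "{f \<in> F. v \<in> f} \<subseteq> insert f0 (ch v)" by blast
    have "3 \<le> card {f \<in> F. v \<in> f}" using opt_degree_steiner[OF opt K v] by (simp add: degree_def)
    also have "\<dots> \<le> card (insert f0 (ch v))" by (rule card_mono[OF _ f0]) (use finch in simp)
    also have "\<dots> \<le> Suc (card (ch v))" by (rule card_insert_le_m1) auto
    finally show ?thesis by simp
  qed
  have "\<exists>f\<in>ch v. \<forall>g\<in>ch v. c f \<le> c g" if "v \<in> \<Union>F - R" for v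
  proof -
    have "ch v \<noteq> {}" using ch2[OF that] by auto
    then have "Min (c ` ch v) \<in> c ` ch v" using finch by (intro Min_in) auto
    then obtain f where "f \<in> ch v" "c f = Min (c ` ch v)" by auto
    then show ?thesis using Min_le[of "c ` ch v"] finch by (intro bexI[of _ f]) auto
  qed
  then obtain pk where pk: "\<And>v. v \<in> \<Union>F - R \<Longrightarrow> pk v \<in> ch v"
    and pkmin: "\<And>v g. v \<in> \<Union>F - R \<Longrightarrow> g \<in> ch v \<Longrightarrow> c (pk v) \<le> c g"
    by metis
  define S where "S = \<Union>F - R"
  have finS: "finite S" using finUF by (simp add: S_def)
  define L where "L = pk ` S"
  have chF: "ch v \<subseteq> F - {e}" for v by (auto simp: ch_def)
  have LF: "L \<subseteq> F" using pk chF by (fastforce simp: L_def S_def)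
  have pos: "0 \<le> c f" if "f \<in> F" for f using that FE cost_nonneg by blast
  have pkF: "pk v \<in> F" if "v \<in> S" for v using pk[of v] that chF by (auto simp: S_def)
  have L_sum: "sum c L \<le> (\<Sum>v\<in>S. c (pk v))"
    unfolding L_def using sum_image_le[of S c pk] finS pos pkF by (simp add: o_def)
  have half: "2 * (\<Sum>v\<in>S. c (pk v)) \<le> sum c F - c e"
  proof -
    have "2 * (\<Sum>v\<in>S. c (pk v)) = (\<Sum>v\<in>S. 2 * c (pk v))" by (rule sum_distrib_left)
    also have "\<dots> \<le> (\<Sum>v\<in>S. sum c (ch v))"
    proof (rule sum_mono)
      fix v assume v: "v \<in> S"
      have "2 * c (pk v) \<le> real (card (ch v)) * c (pk v)"
        using ch2[of v] v pos[OF pkF[OF v]] by (intro mult_right_mono) (auto simp: S_def)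
      also have "\<dots> \<le> sum c (ch v)"
        by (rule sum_bounded_below) (use pkmin v in \<open>auto simp: S_def\<close>)
      finally show "2 * c (pk v) \<le> sum c (ch v)" .
    qed
    also have "\<dots> = sum c (\<Union>(ch ` S))"
    proof (rule sum.UNION_disjoint[symmetric])
      \<comment> \<open>An edge that is a child edge of both its ends would have a detour through
        \<open>a\<close>, although it is a bridge.\<close>
      show "\<forall>u\<in>S. \<forall>v\<in>S. u \<noteq> v \<longrightarrow> ch u \<inter> ch v = {}"
      proof (intro ballI impI, rule ccontr)
        fix u v assume uv: "u \<noteq> v" "ch u \<inter> ch v \<noteq> {}"
        then obtain f where f: "f \<in> F" "u \<in> f" "v \<in> f" "conn (F - {f}) a u" "conn (F - {f}) a v"
          by (auto simp: ch_def)
        obtain z where "f = {u, z}" using edge_memE f FE by (metis subsetD)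
        then have "f = {u, v}" using f uv by auto
        then show False using conn_via[OF f(4,5)] bridge f(1) by blast
      qed
    qed (use finS finch in auto)
    also have "\<dots> \<le> sum c (F - {e})"
      by (rule sum_mono_E) (use chF FE in auto)
    also have "\<dots> = sum c F - c e" using e finF by (simp add: sum_diff1)
    finally show ?thesis .
  qed
  have few: "(\<Sum>v\<in>S. c (pk v)) \<le> real b * c e"
  proof -
    have "(\<Sum>v\<in>S. c (pk v)) \<le> real (card S) * c e"
      by (rule sum_bounded_above) (use emax pkF in auto)
    also have "\<dots> \<le> real b * c e"
      using card_steiner_le pos[OF e] by (intro mult_right_mono) (auto simp: S_def)
    finally show ?thesis .
  qed
  \<comment> \<open>The bound \<open>half\<close>, taken \<open>b\<close> times, stays below
    \<open>b * sum c F\<close> by \<open>b * c e\<close>; this gap is what \<open>few\<close> needs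
    for the remaining copy of the sum.\<close>
  have "(2 * real b + 1) * sum c L \<le> (2 * real b + 1) * (\<Sum>v\<in>S. c (pk v))"
    by (rule mult_left_mono[OF L_sum]) simp
  also have "\<dots> = real b * (2 * (\<Sum>v\<in>S. c (pk v))) + (\<Sum>v\<in>S. c (pk v))"
    by (simp add: algebra_simps)
  also have "\<dots> \<le> real b * (sum c F - c e) + real b * c e"
    by (rule add_mono[OF mult_left_mono[OF half] few]) simp
  also have "\<dots> = real b * sum c F" by (simp add: algebra_simps)
  finally have cost: "(2 * real b + 1) * sum c L \<le> real b * sum c F" .

  \<comment> \<open>The side of \<open>a\<close> grows strictly when picks are followed downwards,
    which bounds the number of steps to a terminal.\<close>
  define A where "A f = {y \<in> \<Union>F. conn (F - {f}) a y}" for f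
  have "\<exists>u. pk v = {v, u}" if "v \<in> S" for v
    using pk[of v] that edge_memE[of "pk v" v] FE by (auto simp: ch_def S_def)
  then obtain up where up: "\<And>v. v \<in> S \<Longrightarrow> pk v = {v, up v}" by metis
  define nx where "nx v = (if v \<in> S then up v else v)" for v
  have nxF: "nx v \<in> \<Union>F" if "v \<in> \<Union>F" for v
    using that up[of v] pkF[of v] by (auto simp: nx_def)
  have K_S: "x \<in> K \<longleftrightarrow> x \<in> \<Union>F \<and> x \<notin> S" for x using terms by (auto simp: S_def)
  have A_less: "card (A (pk v)) < card (A (pk (nx v)))" if v: "v \<in> S" and n: "nx v \<in> S" for v
  proof (rule psubset_card_mono)
    let ?u = "nx v"
    have pv: "pk v = {v, ?u}" using up v by (simp add: nx_def)
    have av: "conn (F - {pk v}) a v" using pk v by (auto simp: ch_def S_def)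
    have nau: "\<not> conn (F - {pk v}) a ?u"
      using conn_via[OF av] bridge[of v ?u] pkF[OF v] pv by auto
    have au: "conn (F - {pk ?u}) a ?u" using pk n by (auto simp: ch_def S_def)
    have "conn (F - {pk ?u}) a y" if "conn (F - {pk v}) a y" for y
      using that
    proof (induction rule: conn_induct)
      case (step y z)
      have "conn (F - {pk v}) a z" by (rule conn_trans[OF step.hyps(1) conn_edge]) (use step.hyps in auto)
      then have "?u \<noteq> y" "?u \<noteq> z" using nau step.hyps by auto
      then have "{y, z} \<noteq> pk ?u" using up[OF n] by auto
      then have "{y, z} \<in> F - {pk ?u}" using step.hyps by auto
      then show ?case using conn_trans[OF step.IH conn_edge] by blast
    qed simp
    moreover have "?u \<in> \<Union>F" using n by (simp add: S_def)
    ultimately show "A (pk v) \<subset> A (pk ?u)" using au nau unfolding A_def by blast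
    show "finite (A (pk ?u))" using finUF unfolding A_def by (rule rev_finite_subset) auto
  qed
  have "\<exists>n. (nx ^^ n) v \<in> K" if "v \<in> \<Union>F" for v
    using that
  proof (induction "card (\<Union>F) - card (A (pk v))" arbitrary: v rule: less_induct)
    case less
    consider "v \<in> K" | "nx v \<in> K" | "v \<in> S" "nx v \<in> S" using K_S less.prems nxF by blast
    then show ?case
    proof cases
      case 1
      then have "(nx ^^ 0) v \<in> K" by simp
      then show ?thesis ..
    next
      case 2
      then have "(nx ^^ 1) v \<in> K" by simp
      then show ?thesis ..
    next
      case 3
      have "card (A (pk (nx v))) \<le> card (\<Union>F)"
        by (rule card_mono[OF finUF]) (auto simp: A_def)
      then have "\<exists>n. (nx ^^ n) (nx v) \<in> K"
        using less.hyps[of "nx v"] A_less[OF 3] nxF[OF less.prems] by simp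
      then obtain n where "(nx ^^ n) (nx v) \<in> K" ..
      then have "(nx ^^ Suc n) v \<in> K" by (simp add: funpow_swap1)
      then show ?thesis ..
    qed
  qed
  then obtain d where d: "\<And>v. v \<in> \<Union>F \<Longrightarrow> (nx ^^ d v) v \<in> K" by metis
  have fixK: "(nx ^^ n) k = k" if "k \<in> K" for n k
    using that K_S by (induction n) (auto simp: nx_def)
  \<comment> \<open>Terminals are fixed by \<open>nx\<close>, so one common number of steps takes
    every vertex to its terminal. As an iterate of \<open>nx\<close>, the map \<open>\<tau>\<close>
    commutes with it and is therefore constant along picked edges.\<close>
  define N where "N = Max (d ` \<Union>F)"
  define \<tau> where "\<tau> = nx ^^ N"
  have \<tau>K: "\<tau> v \<in> K" if "v \<in> \<Union>F" for v
  proof -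
    have "d v \<le> N" using that finUF by (auto simp: N_def)
    then have "\<tau> v = (nx ^^ (N - d v)) ((nx ^^ d v) v)"
      by (metis \<tau>_def add.commute comp_apply funpow_add le_add_diff_inverse)
    then show ?thesis using d[OF that] fixK by simp
  qed
  have "\<tau> v = \<tau> (nx v)" if "v \<in> \<Union>F" for v
  proof -
    have "\<tau> (nx v) = nx (\<tau> v)" by (simp add: \<tau>_def funpow_swap1)
    then show ?thesis using fixK[OF \<tau>K[OF that], of 1] by simp
  qed
  then have \<tau>L: "\<tau> x = \<tau> y" if "{x, y} \<in> L" for x y
    using that up by (force simp: L_def S_def nx_def doubleton_eq_iff)
  have "conn L v (nx v)" for v
    using up[of v] by (auto simp: nx_def L_def intro!: conn_edge)
  then have "conn L v ((nx ^^ n) v)" for v n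
    by (induction n) (auto intro: conn_trans)
  then have "conn L v (\<tau> v)" for v by (simp add: \<tau>_def)
  then show ?thesis using LF \<tau>K fixK \<tau>L cost unfolding \<tau>_def by blast
qed

end

end

section \<open>Exchanging tree edges for components\<close>

text \<open>Hyperedges connect \<open>R\<close> precisely when every function constant on each of
  them is constant on \<open>R\<close>. In this form connectivity is compatible with contractions
  and needs no walks in hypergraphs.\<close>

definition const_on :: "('a \<Rightarrow> 'b) \<Rightarrow> 'a set \<Rightarrow> bool" where
  "const_on g S \<longleftrightarrow> (\<forall>x\<in>S. \<forall>y\<in>S. g x = g y)"

lemma const_onD: "const_on g S \<Longrightarrow> x \<in> S \<Longrightarrow> y \<in> S \<Longrightarrow> g x = g y"
  unfolding const_on_def by blast

text \<open>
  The edges \<open>p i\<close>-\<open>q i\<close> for \<open>i \<in> I\<close>, together with the set \<open>K\<close> as a hyperedge, connect \<open>R\<close>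
  after contracting the fibres of \<open>f\<close>.
\<close>

definition glued :: "('a \<Rightarrow> 'a) \<Rightarrow> ('i \<Rightarrow> 'a) \<Rightarrow> ('i \<Rightarrow> 'a) \<Rightarrow> 'i set \<Rightarrow> 'a set \<Rightarrow> 'a set \<Rightarrow> bool" where
  "glued f p q I K R \<longleftrightarrow>
     (\<forall>g :: 'a \<Rightarrow> 'a. (\<forall>x y. f x = f y \<longrightarrow> g x = g y) \<longrightarrow> (\<forall>i\<in>I. g (p i) = g (q i)) \<longrightarrow>
        const_on g K \<longrightarrow> const_on g R)"

lemma gluedD:
  fixes g :: "'a \<Rightarrow> 'a"
  assumes "glued f p q I K R" "\<And>x y. f x = f y \<Longrightarrow> g x = g y" "\<And>i. i \<in> I \<Longrightarrow> g (p i) = g (q i)"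
    "const_on g K"
  shows "const_on g R"
  using assms(1)[unfolded glued_def, THEN spec, of g] assms(2-4) by blast

section \<open>Contracting edges and counting classes\<close>

definition merge :: "('a \<Rightarrow> 'b) \<Rightarrow> 'a \<Rightarrow> 'a \<Rightarrow> 'a \<Rightarrow> 'b" where
  "merge f u v x = (if f x = f v then f u else f x)"

text \<open>This is the universal property of contracting an edge. It makes an edge in
  \<open>I\<close> interchangeable with a coarser \<open>f\<close>, which drives the inductions on
  \<open>I\<close>.\<close>

lemma merge_kernel:
  "(\<forall>x y. merge f u v x = merge f u v y \<longrightarrow> g x = g y) \<longleftrightarrow>
     (\<forall>x y. f x = f y \<longrightarrow> g x = g y) \<and> g u = g v"
proof (intro iffI conjI allI impI)
  assume *: "\<forall>x y. merge f u v x = merge f u v y \<longrightarrow> g x = g y"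
  show "g x = g y" if "f x = f y" for x y
    by (rule *[rule_format]) (simp only: merge_def that)
  show "g u = g v" by (rule *[rule_format]) (simp add: merge_def)
next
  fix x y
  assume *: "(\<forall>x y. f x = f y \<longrightarrow> g x = g y) \<and> g u = g v"
  assume eq: "merge f u v x = merge f u v y"
  \<comment> \<open>The point \<open>a\<close> is \<open>u\<close> if \<open>z\<close> lies in the
    class of \<open>v\<close>, and \<open>z\<close> itself otherwise.\<close>
  have rep: "\<exists>a. merge f u v z = f a \<and> g z = g a" for z
  proof (cases "f z = f v")
    case True
    then have "g z = g u" using * by metis
    then show ?thesis using True by (intro exI[of _ u]) (simp only: merge_def if_True simp_thms)
  next
    case False
    then show ?thesis by (intro exI[of _ z]) (simp only: merge_def if_False simp_thms)
  qed
  obtain a b where "merge f u v x = f a" "g x = g a" "merge f u v y = f b" "g y = g b"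
    using rep[of x] rep[of y] by blast
  moreover from this eq have "f a = f b" by simp
  ultimately show "g x = g y" using * by metis
qed

lemma glued_merge: "glued (merge f (p i) (q i)) p q I K R \<longleftrightarrow> glued f p q (insert i I) K R"
  unfolding glued_def merge_kernel ball_simps(7) imp_conjL by (rule refl)

lemma glued_insert_trivial:
  assumes "f (p i) = f (q i)"
  shows "glued f p q (insert i I) K R \<longleftrightarrow> glued f p q I K R"
proof -
  have "g (p i) = g (q i)" if "\<forall>x y. f x = f y \<longrightarrow> g x = g y" for g :: "'a \<Rightarrow> 'a"
    using that assms by metis
  then show ?thesis unfolding glued_def ball_simps(7) by (intro all_cong1 imp_cong refl) blast
qed

lemma sum_UN_le:
  fixes h :: "'a \<Rightarrow> real"
  assumes "finite I" "\<And>i. i \<in> I \<Longrightarrow> finite (A i)" "\<And>i a. i \<in> I \<Longrightarrow> a \<in> A i \<Longrightarrow> 0 \<le> h a"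
  shows "sum h (\<Union>(A ` I)) \<le> (\<Sum>i\<in>I. sum h (A i))"
  using assms
proof (induction I rule: finite_induct)
  case (insert i I)
  have "finite (\<Union>(A ` I))" "finite (A i)" using insert by auto
  moreover have "0 \<le> sum h (A i \<inter> \<Union>(A ` I))" using insert.prems by (intro sum_nonneg) auto
  ultimately have "sum h (A i \<union> \<Union>(A ` I)) \<le> sum h (A i) + sum h (\<Union>(A ` I))"
    using sum.union_inter[of "A i" "\<Union>(A ` I)" h] by linarith
  also have "\<dots> \<le> sum h (A i) + (\<Sum>i\<in>I. sum h (A i))"
    by (intro add_left_mono insert.IH) (use insert.prems in auto)
  finally show ?case using insert.hyps by simp
qed simp

lemma merge_image:
  assumes "u \<in> S" "f u \<noteq> f v"
  shows "merge f u v ` S = f ` S - {f v}"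
  using assms by (auto simp: merge_def image_iff)

lemma card_merge:
  assumes "finite S" "u \<in> S" "v \<in> S" "f u \<noteq> f v"
  shows "card (f ` S) = Suc (card (merge f u v ` S))"
  using assms card_Suc_Diff1[of "f ` S" "f v"] by (simp add: merge_image)

text \<open>A contraction costs \<open>S\<close> a value only if \<open>S\<close> meets both
  classes; if it meets only the class of \<open>v\<close>, the value \<open>f v\<close> is merely
  renamed to \<open>f u\<close>.\<close>

lemma card_merge_cases:
  assumes "finite S" "f u \<noteq> f v"
  shows "card (merge f u v ` S) = card (f ` S) \<or>
    f u \<in> f ` S \<and> f v \<in> f ` S \<and> card (f ` S) = Suc (card (merge f u v ` S))"
proof (cases "f v \<in> f ` S")
  case False
  then have "f x \<noteq> f v" if "x \<in> S" for x using that by (metis imageI)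
  then have "merge f u v ` S = f ` S"
    unfolding merge_def by (intro image_cong) simp_all
  then show ?thesis by simp
next
  case v: True
  show ?thesis
  proof (cases "f u \<in> f ` S")
    case True
    then have "merge f u v ` S = f ` S - {f v}"
      using assms(2) by (auto simp: merge_def image_iff)
    then show ?thesis using True v assms card_Suc_Diff1[of "f ` S" "f v"] by simp
  next
    case False
    then have "merge f u v ` S = insert (f u) (f ` S - {f v})"
      using v by (auto simp: merge_def image_iff)
    moreover have "card (insert (f u) (f ` S - {f v})) = card (f ` S)"
      using False v assms card_Suc_Diff1[of "f ` S" "f v"] by simp
    ultimately show ?thesis by simp
  qed
qed

text \<open>With no edges and no hyperedge left, \<open>f\<close> is itself an admissible test
  function.\<close>

lemma glued_empty_card:
  assumes "glued f p q {} {} R"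
  shows "card (f ` R) \<le> 1"
proof -
  have c: "const_on f R" by (rule gluedD[OF assms]) (simp_all add: const_on_def)
  show ?thesis
  proof (cases "R = {}")
    case False
    then obtain x where x: "x \<in> R" by blast
    have "f ` R \<subseteq> {f x}" using const_onD[OF c _ x] by (intro image_subsetI) simp
    then show ?thesis using card_mono[of "{f x}" "f ` R"] by simp
  qed simp
qed

text \<open>Each contraction loses at most one class, and at most one class remains at the
  end.\<close>

lemma glued_card_le:
  assumes "finite I" "finite R" "glued f p q I {} R"
  shows "card (f ` R) \<le> Suc (card I)"
  using assms(1,3)
proof (induction I arbitrary: f rule: finite_induct)
  case empty
  then show ?case using glued_empty_card[OF empty] by simp
next
  case (insert i I)
  let ?f = "merge f (p i) (q i)"
  have "f ` R \<subseteq> insert (f (q i)) (?f ` R)" by (auto simp: merge_def image_iff)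
  then have "card (f ` R) \<le> card (insert (f (q i)) (?f ` R))"
    using assms(2) by (intro card_mono) auto
  also have "\<dots> \<le> Suc (card (?f ` R))" by (rule card_insert_le_m1) auto
  also have "\<dots> \<le> Suc (Suc (card I))" using insert by (simp add: glued_merge)
  finally show ?case using insert by simp
qed

text \<open>Edges are scanned one at a time: one whose ends are already identified is dropped, any
  other is kept and contracted.\<close>

lemma glued_spanning_tree:
  assumes "finite I" "finite R" "R \<noteq> {}" "\<And>i. i \<in> I \<Longrightarrow> p i \<in> R \<and> q i \<in> R" "glued f p q I {} R"
  shows "\<exists>T\<subseteq>I. glued f p q T {} R \<and> card (f ` R) = Suc (card T)"
  using assms(1,4,5)
proof (induction I arbitrary: f rule: finite_induct)
  case empty
  have "card (f ` R) \<noteq> 0" using assms(2,3) by simp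
  then have "card (f ` R) = 1" using glued_empty_card[OF empty(2)] by simp
  then show ?case using empty by auto
next
  case (insert i I)
  show ?case
  proof (cases "f (p i) = f (q i)")
    case True
    then have "glued f p q I {} R"
      using insert.prems(2) glued_insert_trivial[of f p i q I "{}" R] True by blast
    then show ?thesis using insert.IH[of f] insert.prems(1) by blast
  next
    case False
    let ?f = "merge f (p i) (q i)"
    have "glued ?f p q I {} R" using insert.prems by (simp add: glued_merge)
    then obtain T where T: "T \<subseteq> I" "glued ?f p q T {} R" "card (?f ` R) = Suc (card T)"
      using insert.IH[of ?f] insert.prems(1) by blast
    have "card (f ` R) = Suc (card (?f ` R))"
      using card_merge[of R "p i" "q i" f] assms(2) False insert.prems(1) by simp
    moreover have "i \<notin> T" "finite T" using T insert.hyps finite_subset by blast+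
    ultimately show ?thesis using T by (intro exI[of _ "insert i T"]) (auto simp: glued_merge)
  qed
qed

text \<open>
  The weight of a cheapest edge is subtracted from all weights; the constraint for \<open>f\<close> pays for
  it. The remaining weights are handled by induction after contracting that edge.
\<close>

lemma tree_exchange:
  fixes w :: "'i \<Rightarrow> real" and x :: "'a set \<Rightarrow> real"
  assumes R: "finite R" and CC: "\<And>K. K \<in> \<C> \<Longrightarrow> K \<subseteq> R \<and> K \<noteq> {} \<and> 0 \<le> x K"
    and lp: "\<And>f :: 'a \<Rightarrow> 'a. real (card (f ` R)) - 1 \<le> (\<Sum>K\<in>\<C>. (real (card (f ` K)) - 1) * x K)"
    and I: "finite I" "\<And>i. i \<in> I \<Longrightarrow> p i \<in> R \<and> q i \<in> R \<and> 0 \<le> w i"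
    and tree: "card (f ` R) = Suc (card I)" "glued f p q I {} R"
  shows "\<exists>D. (\<forall>K\<in>\<C>. D K \<subseteq> I \<and> card (f ` K) = Suc (card (D K)) \<and> glued f p q (I - D K) K R) \<and>
     sum w I \<le> (\<Sum>K\<in>\<C>. x K * sum w (D K))"
  using I tree
proof (induction "card I" arbitrary: I f w)
  case 0
  then have "I = {}" by simp
  have "card (f ` K) = 1" if K: "K \<in> \<C>" for K
  proof -
    have "finite K" using CC[OF K] R finite_subset by blast
    then have "card (f ` K) \<noteq> 0" using CC[OF K] by simp
    moreover have "card (f ` K) \<le> card (f ` R)" using CC[OF K] R by (intro card_mono) auto
    ultimately show ?thesis using 0 by simp
  qed
  moreover have "glued f p q {} K R" for K
    unfolding glued_def
  proof (intro allI impI)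
    fix g :: "'a \<Rightarrow> 'a" assume g: "\<forall>x y. f x = f y \<longrightarrow> g x = g y"
    show "const_on g R"
    proof (rule gluedD[OF 0(5)])
      show "g x = g y" if "f x = f y" for x y using g that by blast
    qed (simp_all add: \<open>I = {}\<close> const_on_def)
  qed
  ultimately show ?case using \<open>I = {}\<close> by (intro exI[of _ "\<lambda>_. {}"]) auto
next
  case (Suc n)
  have "I \<noteq> {}" using Suc.hyps(2) by auto
  then have "Min (w ` I) \<in> w ` I" using Suc.prems(1) by (intro Min_in) auto
  then obtain i where i: "i \<in> I" "w i = Min (w ` I)" by auto
  have imin: "w i \<le> w j" if "j \<in> I" for j using that i Suc.prems(1) by auto
  define I' where "I' = I - {i}"
  have I': "I = insert i I'" "i \<notin> I'" "finite I'" "n = card I'"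
    using i Suc.prems(1) Suc.hyps(2) by (auto simp: I'_def)
  \<comment> \<open>An edge within a class could be dropped, but \<open>card I\<close> edges are
    only just enough for the number of classes.\<close>
  have ne: "f (p i) \<noteq> f (q i)"
  proof
    assume "f (p i) = f (q i)"
    then have "glued f p q I' {} R"
      using Suc.prems(4) glued_insert_trivial[of f p i q I'] by (simp add: I'(1))
    then show False using glued_card_le[OF I'(3) R] Suc.prems(3) I' by fastforce
  qed
  define f' where "f' = merge f (p i) (q i)"
  define w' where "w' j = w j - w i" for j
  have cardf': "card (f ` R) = Suc (card (f' ` R))"
    unfolding f'_def using card_merge[of R "p i" "q i" f] R ne Suc.prems(2)[OF i(1)] by simp
  have "\<exists>D. (\<forall>K\<in>\<C>. D K \<subseteq> I' \<and> card (f' ` K) = Suc (card (D K)) \<and> glued f' p q (I' - D K) K R) \<and>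
     sum w' I' \<le> (\<Sum>K\<in>\<C>. x K * sum w' (D K))"
  proof (rule Suc.hyps(1)[OF I'(4,3)])
    show "p j \<in> R \<and> q j \<in> R \<and> 0 \<le> w' j" if "j \<in> I'" for j
      using that Suc.prems(2)[of j] imin[of j] I' by (simp add: w'_def)
    show "card (f' ` R) = Suc (card I')" using cardf' Suc.prems(3) I' by simp
    show "glued f' p q I' {} R" using Suc.prems(4) by (simp add: f'_def glued_merge I'(1))
  qed
  then obtain D' where D': "\<And>K. K \<in> \<C> \<Longrightarrow> D' K \<subseteq> I'" "\<And>K. K \<in> \<C> \<Longrightarrow> card (f' ` K) = Suc (card (D' K))"
      "\<And>K. K \<in> \<C> \<Longrightarrow> glued f' p q (I' - D' K) K R"
    and le: "sum w' I' \<le> (\<Sum>K\<in>\<C>. x K * sum w' (D' K))" by blast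
  \<comment> \<open>\<open>K\<close> loses a class under the contraction just when it meets the
    classes of both ends of \<open>i\<close>. In that case \<open>K\<close> can stand in for
    \<open>i\<close>; otherwise \<open>i\<close> is kept.\<close>
  define D where "D K = (if card (f' ` K) = card (f ` K) then D' K else insert i (D' K))" for K
  have finD': "finite (D' K)" "i \<notin> D' K" if "K \<in> \<C>" for K
    using D'(1)[OF that] I' finite_subset by auto
  have D: "D K \<subseteq> I \<and> card (f ` K) = Suc (card (D K)) \<and> glued f p q (I - D K) K R" if K: "K \<in> \<C>" for K
  proof (cases "card (f' ` K) = card (f ` K)")
    case True
    have "I - D' K = insert i (I' - D' K)" using finD'[OF K] I' by auto
    then have "glued f p q (I - D' K) K R"
      using D'(3)[OF K] by (simp add: f'_def glued_merge)
    then show ?thesis using True D'(1,2)[OF K] I' by (auto simp: D_def)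
  next
    case False
    have fK: "finite K" using CC[OF K] R finite_subset by blast
    have k: "f (p i) \<in> f ` K" "f (q i) \<in> f ` K" "card (f ` K) = Suc (card (f' ` K))"
      using card_merge_cases[of K f "p i" "q i"] fK ne False by (auto simp: f'_def)
    have IDK: "I - D K = I' - D' K" using False I' by (auto simp: D_def)
    have "glued f p q (I - D K) K R"
      unfolding glued_def
    proof (intro allI impI)
      fix g :: "'a \<Rightarrow> 'a"
      assume g: "\<forall>x y. f x = f y \<longrightarrow> g x = g y" "\<forall>j\<in>I - D K. g (p j) = g (q j)" "const_on g K"
      obtain k1 k2 where k12: "k1 \<in> K" "f (p i) = f k1" "k2 \<in> K" "f (q i) = f k2" using k by blast
      then have "g (p i) = g k1" "g (q i) = g k2" using g(1) by blast+
      then have "g (p i) = g (q i)" using const_onD[OF g(3) k12(1) k12(3)] by simp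
      then have "\<forall>x y. f' x = f' y \<longrightarrow> g x = g y" unfolding f'_def merge_kernel using g(1) by blast
      then show "const_on g R" using gluedD[OF D'(3)[OF K], of g] g(2,3) unfolding IDK by blast
    qed
    then show ?thesis using False D'(1,2)[OF K] I' k finD'[OF K] by (auto simp: D_def)
  qed
  \<comment> \<open>\<open>D K\<close> has one edge less than \<open>K\<close> has classes, so
    restoring \<open>w i\<close> on each edge yields the coefficient of \<open>x K\<close> in the
    constraint for \<open>f\<close>.\<close>
  have sumD: "sum w (D K) = sum w' (D' K) + (real (card (f ` K)) - 1) * w i" if K: "K \<in> \<C>" for K
  proof -
    have "sum w (D K) = (\<Sum>j\<in>D K. w' j + w i)" by (simp add: w'_def)
    also have "\<dots> = sum w' (D K) + real (card (D K)) * w i" by (simp add: sum.distrib)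
    also have "sum w' (D K) = sum w' (D' K)"
      using finD'[OF K] by (simp add: D_def w'_def)
    also have "real (card (D K)) = real (card (f ` K)) - 1" using D[OF K] by simp
    finally show ?thesis .
  qed
  have "sum w I = (\<Sum>j\<in>I. w' j + w i)" by (simp add: w'_def)
  also have "\<dots> = sum w' I + real (card I) * w i" by (simp add: sum.distrib)
  also have "sum w' I = sum w' I'" using I' by (simp add: w'_def)
  also have "real (card I) = real (card (f ` R)) - 1" using Suc.prems(3) by simp
  also have "sum w' I' + (real (card (f ` R)) - 1) * w i
      \<le> (\<Sum>K\<in>\<C>. x K * sum w' (D' K)) + (\<Sum>K\<in>\<C>. (real (card (f ` K)) - 1) * x K) * w i"
    using le lp[of f] Suc.prems(2)[OF i(1)] by (intro add_mono mult_right_mono) auto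
  also have "\<dots> = (\<Sum>K\<in>\<C>. x K * sum w' (D' K) + (real (card (f ` K)) - 1) * x K * w i)"
    by (simp add: sum.distrib sum_distrib_right)
  also have "\<dots> = (\<Sum>K\<in>\<C>. x K * sum w (D K))"
    by (rule sum.cong) (simp_all add: sumD algebra_simps)
  finally show ?case using D by blast
qed

section \<open>Upper bound\<close>

lemma partition_function:
  assumes "partition_on R \<pi>"
  obtains f :: "'a \<Rightarrow> 'a" where
    "\<And>K. K \<subseteq> R \<Longrightarrow> card {P \<in> \<pi>. P \<inter> K \<noteq> {}} = card (f ` K)" "card \<pi> = card (f ` R)"
proof -
  define h :: "'a set \<Rightarrow> 'a" where "h P = (SOME y. y \<in> P)" for P
  define part where "part x = (THE P. P \<in> \<pi> \<and> x \<in> P)" for x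
  have h: "h P \<in> P" if "P \<in> \<pi>" for P
    using that assms some_in_eq unfolding h_def partition_on_def by metis
  have uniq: "P = Q" if "P \<in> \<pi>" "Q \<in> \<pi>" "y \<in> P" "y \<in> Q" for P Q y
    using assms that by (auto simp: partition_on_def disjoint_def)
  have inj: "inj_on h \<pi>" using uniq h by (intro inj_onI) metis
  have part_eq: "part x = P" if "P \<in> \<pi>" "x \<in> P" for x P
    unfolding part_def using that uniq by (intro the_equality) auto
  have part: "part x \<in> \<pi>" "x \<in> part x" if x: "x \<in> R" for x
  proof -
    obtain P where "P \<in> \<pi>" "x \<in> P" using assms x by (auto simp: partition_on_def)
    then show "part x \<in> \<pi>" "x \<in> part x" using part_eq by auto
  qed
  have img: "{P \<in> \<pi>. P \<inter> K \<noteq> {}} = part ` K" if "K \<subseteq> R" for K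
  proof (intro equalityI subsetI)
    fix P assume "P \<in> {P \<in> \<pi>. P \<inter> K \<noteq> {}}"
    then obtain x where "P \<in> \<pi>" "x \<in> P" "x \<in> K" by blast
    then show "P \<in> part ` K" using part_eq by blast
  next
    fix P assume "P \<in> part ` K"
    then obtain x where "P = part x" "x \<in> K" by blast
    then show "P \<in> {P \<in> \<pi>. P \<inter> K \<noteq> {}}" using part[of x] that by blast
  qed
  have 1: "card {P \<in> \<pi>. P \<inter> K \<noteq> {}} = card ((\<lambda>x. h (part x)) ` K)" if K: "K \<subseteq> R" for K
  proof -
    have "inj_on h (part ` K)" using inj part K by (blast intro: inj_on_subset)
    then have "card (h ` part ` K) = card (part ` K)" by (rule card_image)
    then show ?thesis using img[OF K] by (simp add: image_image)
  qed
  have "P \<inter> R \<noteq> {}" if "P \<in> \<pi>" for P using h[OF that] that assms unfolding partition_on_def by blast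
  then have "{P \<in> \<pi>. P \<inter> R \<noteq> {}} = \<pi>" by blast
  then show ?thesis using that[of "\<lambda>x. h (part x)"] 1 1[of R] by simp
qed

lemma function_partition:
  assumes "finite R"
  obtains \<pi> where "partition_on R \<pi>"
    "\<And>K. K \<subseteq> R \<Longrightarrow> card {P \<in> \<pi>. P \<inter> K \<noteq> {}} = card (f ` K)" "card \<pi> = card (f ` R)"
proof -
  define fib where "fib y = {x \<in> R. f x = y}" for y
  have inj: "inj_on fib (f ` R)" by (rule inj_onI) (auto simp: fib_def)
  have "partition_on R (fib ` f ` R)"
    by (auto simp: partition_on_def disjoint_def fib_def)
  moreover have "card {P \<in> fib ` f ` R. P \<inter> K \<noteq> {}} = card (f ` K)" if K: "K \<subseteq> R" for K
  proof -
    have "{P \<in> fib ` f ` R. P \<inter> K \<noteq> {}} = fib ` f ` K"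
    proof (intro equalityI subsetI)
      fix P assume "P \<in> {P \<in> fib ` f ` R. P \<inter> K \<noteq> {}}"
      then obtain y x where "P = fib y" "x \<in> fib y" "x \<in> K" by blast
      then show "P \<in> fib ` f ` K" by (auto simp: fib_def)
    next
      fix P assume "P \<in> fib ` f ` K"
      then obtain x where "x \<in> K" "P = fib (f x)" by blast
      then show "P \<in> {P \<in> fib ` f ` R. P \<inter> K \<noteq> {}}" using K by (auto simp: fib_def)
    qed
    moreover have "inj_on fib (f ` K)" using inj K by (blast intro: inj_on_subset)
    ultimately show ?thesis by (simp add: card_image)
  qed
  moreover have "card (fib ` f ` R) = card (f ` R)" using inj by (rule card_image)
  ultimately show ?thesis using that by blast
qed

text \<open>The parts are the fibres of \<open>f\<close>. The codomain is left free because the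
  constraint separating one terminal from the others will use a truth-valued map.\<close>

lemma lp_function_constraint:
  fixes f :: "'a \<Rightarrow> 'b"
  assumes "x \<in> lp_feasible r V E R" "finite R"
  shows "real (card (f ` R)) - 1 \<le> (\<Sum>K\<in>full_comps r V E R. (real (card (f ` K)) - 1) * x K)"
proof -
  obtain \<pi> where \<pi>: "partition_on R \<pi>"
    "\<And>K. K \<subseteq> R \<Longrightarrow> card {P \<in> \<pi>. P \<inter> K \<noteq> {}} = card (f ` K)" "card \<pi> = card (f ` R)"
    by (rule function_partition[OF assms(2), of f]) (rule that)
  have "real (card \<pi>) - 1 \<le> (\<Sum>K\<in>full_comps r V E R. rank_contrib \<pi> K * x K)"
    using assms(1) \<pi>(1) by (simp add: lp_feasible_def)
  also have "\<dots> = (\<Sum>K\<in>full_comps r V E R. (real (card (f ` K)) - 1) * x K)"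
    by (rule sum.cong) (auto simp: rank_contrib_def full_comps_def \<pi>(2))
  finally show ?thesis using \<pi>(3) by simp
qed

text \<open>Each set is replaced by a star on its image, with one edge less than the image has
  elements. The stars together connect the image of \<open>R\<close>, which bounds their number of
  edges from below. Hence connected families are integral solutions.\<close>

lemma connected_family_rank:
  fixes f :: "'a \<Rightarrow> 'a"
  assumes "finite R" "finite \<K>" "\<And>K. K \<in> \<K> \<Longrightarrow> K \<subseteq> R \<and> K \<noteq> {}"
    and conn: "\<And>g :: 'a \<Rightarrow> 'a. (\<And>K. K \<in> \<K> \<Longrightarrow> const_on g K) \<Longrightarrow> const_on g R"
  shows "real (card (f ` R)) - 1 \<le> (\<Sum>K\<in>\<K>. real (card (f ` K)) - 1)"
proof -
  define k where "k K = (SOME y. y \<in> K)" for K :: "'a set"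
  have k: "k K \<in> K" if "K \<in> \<K>" for K using assms(3)[OF that] some_in_eq unfolding k_def by metis
  \<comment> \<open>Edges are tagged with their set because stars of different sets may share
    edges.\<close>
  define I where "I = Sigma \<K> (\<lambda>K. f ` K - {f (k K)})"
  have finK: "finite K" if "K \<in> \<K>" for K using assms(1,3) that finite_subset by blast
  have finI: "finite I" unfolding I_def using assms(2) finK by auto
  have "glued id (\<lambda>i. f (k (fst i))) snd I {} (f ` R)"
    unfolding glued_def
  proof (intro allI impI)
    fix g :: "'a \<Rightarrow> 'a" assume g: "\<forall>i\<in>I. g (f (k (fst i))) = g (snd i)"
    have "const_on (g \<circ> f) R"
    proof (rule conn)
      fix K assume K: "K \<in> \<K>"
      have "g (f x) = g (f (k K))" if "x \<in> K" for x
      proof (cases "f x = f (k K)")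
        case False
        then have "(K, f x) \<in> I" using K that by (simp add: I_def)
        then show ?thesis using bspec[OF g, of "(K, f x)"] by simp
      qed simp
      then show "const_on (g \<circ> f) K" unfolding const_on_def comp_def by metis
    qed
    then show "const_on g (f ` R)" unfolding const_on_def comp_def by blast
  qed
  then have "card (f ` R) \<le> Suc (card I)"
    using glued_card_le[OF finI, of "f ` R" id] assms(1) by simp
  moreover have "card I = (\<Sum>K\<in>\<K>. card (f ` K - {f (k K)}))"
    unfolding I_def using assms(2) finK by (simp add: card_SigmaI)
  moreover have "real (\<Sum>K\<in>\<K>. card (f ` K - {f (k K)})) = (\<Sum>K\<in>\<K>. real (card (f ` K)) - 1)"
    unfolding of_nat_sum
  proof (rule sum.cong)
    fix K assume K: "K \<in> \<K>"
    have "card (f ` K) = Suc (card (f ` K - {f (k K)}))"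
      using k[OF K] finK[OF K] card_Suc_Diff1[of "f ` K" "f (k K)"] by simp
    then show "real (card (f ` K - {f (k K)})) = real (card (f ` K)) - 1" by simp
  qed simp
  ultimately show ?thesis by linarith
qed

section \<open>Cheapest connected families against fractional solutions\<close>

context steiner
begin

definition connected_family :: "nat \<Rightarrow> 'a set set \<Rightarrow> bool" where
  "connected_family r \<K> \<longleftrightarrow> \<K> \<subseteq> full_comps r V E R \<and>
     (\<forall>g :: 'a \<Rightarrow> 'a. (\<forall>K\<in>\<K>. const_on g K) \<longrightarrow> const_on g R)"

lemma full_comps_sub: "K \<in> full_comps r V E R \<Longrightarrow> K \<subseteq> R \<and> K \<noteq> {} \<and> 2 \<le> card K \<and> card K \<le> r"
  by (auto simp: full_comps_def)

lemma finite_full_comps: "finite (full_comps r V E R)"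
  using full_comps_sub finite_R by (metis PowI finite_Pow_iff finite_subset subsetI)

lemma comp_cost_nonneg: "K \<in> full_comps r V E R \<Longrightarrow> 0 \<le> comp_cost V E R c K"
  using full_comps_optimal[of K r] cost_nonneg
  by (metis opt_sub sum_nonneg subsetD)

text \<open>Pairs of terminals already suffice: preprocessing joins them by edges and
  \<open>2 \<le> r\<close> admits them. This also makes both programs feasible.\<close>

lemma connected_family_all: "2 \<le> r \<Longrightarrow> connected_family r (full_comps r V E R)"
  unfolding connected_family_def
proof (intro conjI allI impI)
  fix g :: "'a \<Rightarrow> 'a" assume r: "2 \<le> r" and g: "\<forall>K\<in>full_comps r V E R. const_on g K"
  show "const_on g R"
    unfolding const_on_def
  proof (intro ballI)
    fix u v assume uv: "u \<in> R" "v \<in> R"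
    show "g u = g v"
    proof (cases "u = v")
      case False
      then have e: "{u, v} \<in> E" using pre uv by (auto simp: preprocessed_def shortest_edge_def)
      have "degree {{u, v}} k \<le> 1" for k
      proof -
        have "card {e \<in> {{u, v}}. k \<in> e} \<le> card {{u, v}}" by (rule card_mono) auto
        then show ?thesis by (simp add: degree_def)
      qed
      moreover have "conn {{u, v}} u v" "conn {{u, v}} v u" by (auto intro!: conn_edge)
      ultimately have "semi_full {u, v} {{u, v}}" using e by (auto simp: semi_full_def)
      then have "{u, v} \<in> full_comps r V E R"
        using semi_full_comp(1)[of "{u, v}" "{{u, v}}" r] uv False r by auto
      then show ?thesis using g by (auto simp: const_on_def)
    qed simp
  qed
qed simp

lemma connected_family_ip:
  assumes "connected_family r \<K>"
  shows "(\<lambda>K. if K \<in> \<K> then 1 else 0) \<in> ip_feasible r V E R"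
    and "lp_cost r V E R c (\<lambda>K. if K \<in> \<K> then 1 else 0) = sum (comp_cost V E R c) \<K>"
proof -
  have sub: "\<K> \<subseteq> full_comps r V E R"
    and conn: "\<And>g :: 'a \<Rightarrow> 'a. (\<And>K. K \<in> \<K> \<Longrightarrow> const_on g K) \<Longrightarrow> const_on g R"
    using assms by (auto simp: connected_family_def)
  have fin: "finite \<K>" using sub finite_full_comps finite_subset by blast
  have ind: "(\<Sum>K\<in>full_comps r V E R. h K * (if K \<in> \<K> then 1 else 0)) = sum h \<K>"
    for h :: "'a set \<Rightarrow> real"
    by (rule sum.mono_neutral_cong_right) (use sub finite_full_comps in auto)
  have "real (card \<pi>) - 1 \<le> sum (rank_contrib \<pi>) \<K>" if \<pi>: "partition_on R \<pi>" for \<pi>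
  proof -
    obtain f :: "'a \<Rightarrow> 'a" where f: "\<And>K. K \<subseteq> R \<Longrightarrow> card {P \<in> \<pi>. P \<inter> K \<noteq> {}} = card (f ` K)"
      "card \<pi> = card (f ` R)" by (rule partition_function[OF \<pi>]) (rule that)
    have "real (card (f ` R)) - 1 \<le> (\<Sum>K\<in>\<K>. real (card (f ` K)) - 1)"
      by (rule connected_family_rank[OF finite_R fin _ conn]) (use sub full_comps_sub in auto)
    also have "\<dots> = sum (rank_contrib \<pi>) \<K>"
      by (rule sum.cong) (use sub full_comps_sub f in \<open>auto simp: rank_contrib_def\<close>)
    finally show ?thesis using f by simp
  qed
  then show "(\<lambda>K. if K \<in> \<K> then 1 else 0) \<in> ip_feasible r V E R"
    unfolding ip_feasible_def lp_feasible_def mem_Collect_eq ind by simp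
  show "lp_cost r V E R c (\<lambda>K. if K \<in> \<K> then 1 else 0) = sum (comp_cost V E R c) \<K>"
    unfolding lp_cost_def by (rule ind)
qed

lemma ip_le_lp:
  assumes qb: "quasi_bipartite b V E R" and r: "2 \<le> r" and x: "x \<in> lp_feasible r V E R"
  shows "\<exists>y\<in>ip_feasible r V E R. (real b + 1) * lp_cost r V E R c y \<le> (2 * real b + 1) * lp_cost r V E R c x"
proof (cases "R = {}")
  case True
  then have "full_comps r V E R = {}" using full_comps_sub by blast
  then show ?thesis using x by (intro bexI[of _ x]) (auto simp: lp_cost_def ip_feasible_def)
next
  case ne: False
  let ?C = "full_comps r V E R" and ?c = "comp_cost V E R c"
  let ?S = "{\<K>. connected_family r \<K>}"
  have finS: "finite ?S"
    using finite_full_comps[of r] by (rule finite_subset[of _ "Pow ?C", rotated, OF iffD2[OF finite_Pow_iff]])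
      (auto simp: connected_family_def)
  have "Min (sum ?c ` ?S) \<in> sum ?c ` ?S"
    using finS connected_family_all[OF r] by (intro Min_in) auto
  then obtain \<K> where \<K>: "connected_family r \<K>" "sum ?c \<K> = Min (sum ?c ` ?S)" by auto
  have opt\<K>: "sum ?c \<K> \<le> sum ?c \<K>'" if "connected_family r \<K>'" for \<K>'
    unfolding \<K>(2) using that finS by (intro Min_le) auto
  have sub: "\<K> \<subseteq> ?C"
    and connK: "\<And>g :: 'a \<Rightarrow> 'a. (\<And>K. K \<in> \<K> \<Longrightarrow> const_on g K) \<Longrightarrow> const_on g R"
    using \<K>(1) by (auto simp: connected_family_def)
  have fin: "finite \<K>" using sub finite_full_comps finite_subset by blast
  have "\<exists>F. optimal K F \<and> ?c K = sum c F" if "K \<in> \<K>" for K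
    using full_comps_optimal[of K r] that sub by blast
  then obtain F where F: "\<And>K. K \<in> \<K> \<Longrightarrow> optimal K (F K)" "\<And>K. K \<in> \<K> \<Longrightarrow> ?c K = sum c (F K)"
    by metis
  have Kp: "K \<subseteq> R" "2 \<le> card K" "card K \<le> r" if "K \<in> \<K>" for K
    using that sub full_comps_sub by blast+
  have FE: "F K \<subseteq> E" if "K \<in> \<K>" for K using opt_sub[OF F(1) Kp(1,2)] that by blast
  define P where "P K L \<tau> \<longleftrightarrow> L \<subseteq> F K \<and> (\<forall>x\<in>\<Union>(F K). \<tau> x \<in> K \<and> conn L x (\<tau> x)) \<and>
    (\<forall>k\<in>K. \<tau> k = k) \<and> (\<forall>x y. {x, y} \<in> L \<longrightarrow> \<tau> x = \<tau> y) \<and>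
    (2 * real b + 1) * sum c L \<le> real b * sum c (F K)" for K L \<tau>
  have "\<forall>K\<in>\<K>. \<exists>L \<tau>. P K L \<tau>"
    unfolding P_def using loss_exists[OF F(1) Kp(1,2) qb] by blast
  then obtain L where "\<forall>K\<in>\<K>. \<exists>\<tau>. P K (L K) \<tau>" by (rule bchoice[THEN exE])
  then obtain \<tau> where P: "\<forall>K\<in>\<K>. P K (L K) (\<tau> K)" by (rule bchoice[THEN exE])
  have L: "L K \<subseteq> F K" and \<tau>: "\<And>x. x \<in> \<Union>(F K) \<Longrightarrow> \<tau> K x \<in> K \<and> conn (L K) x (\<tau> K x)"
    and \<tau>k: "\<And>k. k \<in> K \<Longrightarrow> \<tau> K k = k" and \<tau>L: "\<And>x y. {x, y} \<in> L K \<Longrightarrow> \<tau> K x = \<tau> K y"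
    and loss: "(2 * real b + 1) * sum c (L K) \<le> real b * sum c (F K)" if "K \<in> \<K>" for K
    using bspec[OF P that] unfolding P_def by blast+
  have "\<exists>u v. f = {u, v}" if "f \<in> E" for f using that edgeE by metis
  then obtain e1 e2 where e12: "\<And>f. f \<in> E \<Longrightarrow> f = {e1 f, e2 f}" by metis
  \<comment> \<open>Pairs take the place of cloned Steiner vertices: an edge occurring in several
    chosen trees counts once for each.\<close>
  define M where "M = Sigma \<K> (\<lambda>K. F K - L K)"
  define p where "p i = \<tau> (fst i) (e1 (snd i))" for i :: "'a set \<times> 'a set"
  define q where "q i = \<tau> (fst i) (e2 (snd i))" for i :: "'a set \<times> 'a set"
  define w where "w i = c (snd i)" for i :: "'a set \<times> 'a set"
  have finF: "finite (F K)" if "K \<in> \<K>" for K using finite_sub[OF FE] that by blast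
  have finM: "finite M" unfolding M_def using fin finF by auto
  have M: "fst i \<in> \<K>" "snd i \<in> F (fst i)" "snd i \<notin> L (fst i)" "snd i \<in> E"
    "e1 (snd i) \<in> \<Union>(F (fst i))" "e2 (snd i) \<in> \<Union>(F (fst i))" if "i \<in> M" for i
  proof -
    show *: "fst i \<in> \<K>" "snd i \<in> F (fst i)" "snd i \<notin> L (fst i)" using that by (auto simp: M_def)
    show E: "snd i \<in> E" using FE * by blast
    show "e1 (snd i) \<in> \<Union>(F (fst i))" "e2 (snd i) \<in> \<Union>(F (fst i))"
      using e12[OF E] *(2) by blast+
  qed
  have Mw: "p i \<in> R \<and> q i \<in> R \<and> 0 \<le> w i" if "i \<in> M" for i
    using \<tau>[OF M(1,5)] \<tau>[OF M(1,6)] Kp(1)[OF M(1)] cost_nonneg[OF M(4)] that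
    unfolding p_def q_def w_def by blast
  have gluedM: "glued id p q M {} R"
    unfolding glued_def
  proof (intro allI impI)
    fix g :: "'a \<Rightarrow> 'a" assume g: "\<forall>i\<in>M. g (p i) = g (q i)"
    show "const_on g R"
    proof (rule connK)
      fix K assume K: "K \<in> \<K>"
      \<comment> \<open>Along a tree, \<open>g\<close> after \<open>\<tau> K\<close> does not
        change: \<open>\<tau> K\<close> identifies the ends of a loss edge, and the other edges are
        covered by the assumption on \<open>g\<close>.\<close>
      have edge: "g (\<tau> K y) = g (\<tau> K z)" if yz: "{y, z} \<in> F K" for y z
      proof (cases "{y, z} \<in> L K")
        case True
        then show ?thesis using \<tau>L[OF K] by simp
      next
        case False
        then have "(K, {y, z}) \<in> M" using K yz by (auto simp: M_def)
        then have "g (\<tau> K (e1 {y, z})) = g (\<tau> K (e2 {y, z}))" using g by (force simp: p_def q_def)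
        moreover have "{y, z} = {e1 {y, z}, e2 {y, z}}" using e12[of "{y, z}"] FE[OF K] yz by blast
        ultimately show ?thesis by (metis doubleton_eq_iff)
      qed
      have "g (\<tau> K k) = g (\<tau> K l)" if "conn (F K) k l" for k l
        using that by (induction rule: conn_induct) (auto dest: edge)
      then have "g k = g l" if "k \<in> K" "l \<in> K" for k l
        using that opt_conn[OF F(1)[OF K] Kp(1,2)[OF K]] \<tau>k[OF K] by metis
      then show "const_on g K" unfolding const_on_def by blast
    qed
  qed
  \<comment> \<open>\<open>D\<close> is deleted from the uncontracted trees while the loss is kept,
    so the ends \<open>p i\<close> and \<open>q i\<close> of a surviving edge stay in one piece. The
    pieces and \<open>Q\<close> therefore form a connected family, which cannot be cheaper than
    \<open>\<K>\<close>. Two cases are used: \<open>Q = {K}\<close> with \<open>K' = K\<close>, and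
    both empty.\<close>
  have exchange: "sum w D \<le> sum ?c Q"
    if D: "D \<subseteq> M" and gl: "glued id p q (M - D) K' R" and Q: "Q \<subseteq> ?C"
      and QK: "\<And>g :: 'a \<Rightarrow> 'a. (\<And>K. K \<in> Q \<Longrightarrow> const_on g K) \<Longrightarrow> const_on g K'" for D K' Q
  proof -
    define DK where "DK K = {f. (K, f) \<in> D}" for K
    have DK: "DK K \<subseteq> F K - L K" for K using D by (auto simp: DK_def M_def)
    define PG where "PG K \<G> \<longleftrightarrow> finite \<G> \<and> \<G> \<subseteq> ?C \<and> sum ?c \<G> \<le> sum c (F K - DK K) \<and>
      (\<forall>k\<in>K. \<forall>l\<in>K. conn (F K - DK K) k l \<longrightarrow> k = l \<or> (\<exists>G\<in>\<G>. k \<in> G \<and> l \<in> G))" for K \<G>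
    have "\<forall>K\<in>\<K>. \<exists>\<G>. PG K \<G>"
      unfolding PG_def using split_component[OF F(1) Kp(1,3)] by blast
    then obtain \<G> where PG: "\<forall>K\<in>\<K>. PG K (\<G> K)" by (rule bchoice[THEN exE])
    have \<G>: "finite (\<G> K)" "\<G> K \<subseteq> ?C" "sum ?c (\<G> K) \<le> sum c (F K - DK K)"
      and \<G>c: "\<And>k l. k \<in> K \<Longrightarrow> l \<in> K \<Longrightarrow> conn (F K - DK K) k l \<Longrightarrow>
        k = l \<or> (\<exists>G\<in>\<G> K. k \<in> G \<and> l \<in> G)" if "K \<in> \<K>" for K
      using bspec[OF PG that] unfolding PG_def by blast+
    let ?N = "Q \<union> \<Union>(\<G> ` \<K>)"
    have finQ: "finite Q" using Q finite_full_comps finite_subset by blast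
    have "connected_family r ?N"
      unfolding connected_family_def
    proof (intro conjI allI impI)
      show "?N \<subseteq> ?C" using Q \<G>(2) by blast
      fix g :: "'a \<Rightarrow> 'a" assume g: "\<forall>K\<in>?N. const_on g K"
      have "g (p i) = g (q i)" if i: "i \<in> M - D" for i
      proof -
        let ?K = "fst i" and ?f = "snd i"
        have iM: "i \<in> M" using i by blast
        have "?f \<notin> DK ?K" using i by (auto simp: DK_def)
        then have "{e1 ?f, e2 ?f} \<in> F ?K - DK ?K" using M(2)[OF iM] e12[OF M(4)[OF iM]] by simp
        then have e: "conn (F ?K - DK ?K) (e1 ?f) (e2 ?f)" by (rule conn_edge)
        have LF: "L ?K \<subseteq> F ?K - DK ?K" using L[OF M(1)[OF iM]] DK by blast
        have "conn (F ?K - DK ?K) (e1 ?f) (p i)" "conn (F ?K - DK ?K) (e2 ?f) (q i)"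
          using \<tau>[OF M(1,5)] \<tau>[OF M(1,6)] iM conn_mono[OF _ LF] unfolding p_def q_def by blast+
        then have "conn (F ?K - DK ?K) (p i) (q i)"
          using conn_trans[OF e] by (intro conn_via[of _ "e1 ?f" "p i"]) auto
        moreover have "p i \<in> ?K" "q i \<in> ?K"
          using \<tau>[OF M(1,5)] \<tau>[OF M(1,6)] iM unfolding p_def q_def by blast+
        ultimately have "p i = q i \<or> (\<exists>G\<in>\<G> ?K. p i \<in> G \<and> q i \<in> G)"
          using \<G>c M(1)[OF iM] by blast
        then show ?thesis
        proof
          assume "\<exists>G\<in>\<G> ?K. p i \<in> G \<and> q i \<in> G"
          then obtain G where G: "G \<in> \<G> ?K" "p i \<in> G" "q i \<in> G" by blast
          have "G \<in> ?N" using G(1) M(1)[OF iM] by blast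
          then have "const_on g G" using g by (rule bspec[rotated])
          then show ?thesis using G(2,3) by (rule const_onD)
        qed simp
      qed
      moreover have "const_on g K'" using QK g by blast
      ultimately show "const_on g R" using gluedD[OF gl, of g] by simp
    qed
    then have "sum ?c \<K> \<le> sum ?c ?N" by (rule opt\<K>)
    \<comment> \<open>Pieces of different trees and members of \<open>Q\<close> may coincide, so the
      sums only bound the cost of the union.\<close>
    also have "\<dots> \<le> sum ?c Q + sum ?c (\<Union>(\<G> ` \<K>))"
    proof -
      have "finite (\<Union>(\<G> ` \<K>))" using fin \<G>(1) by blast
      moreover have "0 \<le> sum ?c (Q \<inter> \<Union>(\<G> ` \<K>))"
        by (rule sum_nonneg) (use Q comp_cost_nonneg in blast)
      ultimately show ?thesis using sum.union_inter[of Q "\<Union>(\<G> ` \<K>)" ?c] finQ by linarith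
    qed
    also have "sum ?c (\<Union>(\<G> ` \<K>)) \<le> (\<Sum>K\<in>\<K>. sum ?c (\<G> K))"
    proof (rule sum_UN_le[OF fin \<G>(1)])
      show "0 \<le> ?c G" if "K \<in> \<K>" "G \<in> \<G> K" for K G
        using comp_cost_nonneg \<G>(2)[OF that(1)] that(2) by blast
    qed
    also have "\<dots> \<le> (\<Sum>K\<in>\<K>. sum c (F K) - sum c (DK K))"
    proof (rule sum_mono)
      fix K assume K: "K \<in> \<K>"
      have "DK K \<subseteq> F K" using DK by blast
      then show "sum ?c (\<G> K) \<le> sum c (F K) - sum c (DK K)"
        using \<G>(3)[OF K] sum_diff[OF finF[OF K], of "DK K" c] by simp
    qed
    also have "\<dots> = sum ?c \<K> - (\<Sum>K\<in>\<K>. sum c (DK K))"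
      using F(2) by (simp add: sum_subtractf)
    also have "(\<Sum>K\<in>\<K>. sum c (DK K)) = sum w D"
    proof -
      have "D = Sigma \<K> DK" using D by (auto simp: DK_def M_def)
      moreover have "\<forall>K\<in>\<K>. finite (DK K)" using DK finF finite_subset by (metis Diff_subset order_trans)
      ultimately show ?thesis using fin by (simp add: sum.Sigma w_def split_def)
    qed
    finally show ?thesis by simp
  qed
  obtain T where T: "T \<subseteq> M" "glued id p q T {} R" "card (id ` R) = Suc (card T)"
    using glued_spanning_tree[OF finM finite_R ne _ gluedM] Mw by blast
  have MT: "M - (M - T) = T" using T by blast
  \<comment> \<open>Edges outside the spanning tree can go without replacement, so by optimality
    they cost nothing in total.\<close>
  have MT0: "sum w (M - T) \<le> 0"
    using exchange[of "M - T" "{}" "{}"] T(2) by (simp add: MT const_on_def)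
  have finT: "finite T" using T finM finite_subset by blast
  have "\<exists>D. (\<forall>K\<in>?C. D K \<subseteq> T \<and> card (id ` K) = Suc (card (D K)) \<and> glued id p q (T - D K) K R) \<and>
     sum w T \<le> (\<Sum>K\<in>?C. x K * sum w (D K))"
  proof (rule tree_exchange[OF finite_R _ _ finT _ T(3,2)])
    show "K \<subseteq> R \<and> K \<noteq> {} \<and> 0 \<le> x K" if "K \<in> ?C" for K
      using that full_comps_sub x by (auto simp: lp_feasible_def)
    show "real (card (f ` R)) - 1 \<le> (\<Sum>K\<in>?C. (real (card (f ` K)) - 1) * x K)" for f :: "'a \<Rightarrow> 'a"
      by (rule lp_function_constraint[OF x finite_R])
    show "p i \<in> R \<and> q i \<in> R \<and> 0 \<le> w i" if "i \<in> T" for i using that Mw T by blast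
  qed
  then obtain D where D: "\<And>K. K \<in> ?C \<Longrightarrow> D K \<subseteq> T" "\<And>K. K \<in> ?C \<Longrightarrow> glued id p q (T - D K) K R"
    and wT: "sum w T \<le> (\<Sum>K\<in>?C. x K * sum w (D K))" by blast
  have wD: "sum w (D K) \<le> ?c K" if K: "K \<in> ?C" for K
  proof -
    \<comment> \<open>Deleting \<open>M - T\<close> as well leaves exactly the tree edges that
      connect \<open>R\<close> together with \<open>K\<close>.\<close>
    have eq: "M - (D K \<union> (M - T)) = T - D K" using T D(1)[OF K] by blast
    have "sum w (D K) \<le> sum w (D K \<union> (M - T))"
      by (rule sum_mono2) (use finM finT D(1)[OF K] Mw T in \<open>auto intro: finite_subset\<close>)
    also have "\<dots> \<le> sum ?c {K}"
      by (rule exchange[of _ K]) (use K D T eq in auto)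
    finally show ?thesis by simp
  qed
  have "sum w M = sum w (M - T) + sum w T" using sum.subset_diff[OF T(1) finM] .
  also have "\<dots> \<le> (\<Sum>K\<in>?C. x K * sum w (D K))" using MT0 wT by simp
  also have "\<dots> \<le> (\<Sum>K\<in>?C. x K * ?c K)"
    using wD x by (intro sum_mono mult_left_mono) (auto simp: lp_feasible_def)
  also have "\<dots> = lp_cost r V E R c x" by (simp add: lp_cost_def mult.commute)
  finally have wM: "sum w M \<le> lp_cost r V E R c x" .
  have "sum w M = (\<Sum>K\<in>\<K>. sum c (F K - L K))"
    unfolding M_def w_def using fin finF by (simp add: sum.Sigma split_def)
  also have "\<dots> = (\<Sum>K\<in>\<K>. sum c (F K) - sum c (L K))"
    by (rule sum.cong) (simp_all add: sum_diff finF L)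
  finally have "(2 * real b + 1) * sum w M = (\<Sum>K\<in>\<K>. (2 * real b + 1) * (sum c (F K) - sum c (L K)))"
    by (simp add: sum_distrib_left)
  \<comment> \<open>Of each tree at least the fraction \<open>(b + 1) / (2 b + 1)\<close> survives
    the removal of the loss.\<close>
  also have "\<dots> \<ge> (\<Sum>K\<in>\<K>. (real b + 1) * ?c K)"
  proof (rule sum_mono)
    fix K assume K: "K \<in> \<K>"
    show "(real b + 1) * ?c K \<le> (2 * real b + 1) * (sum c (F K) - sum c (L K))"
      using loss[OF K] F(2)[OF K] by (simp add: algebra_simps)
  qed
  finally have "(real b + 1) * sum ?c \<K> \<le> (2 * real b + 1) * sum w M"
    by (simp add: sum_distrib_left)
  also have "\<dots> \<le> (2 * real b + 1) * lp_cost r V E R c x" using wM by (intro mult_left_mono) auto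
  finally show ?thesis using connected_family_ip[OF \<K>(1)] by (intro bexI) auto
qed

lemma lp_cost_nonneg: "x \<in> lp_feasible r V E R \<Longrightarrow> 0 \<le> lp_cost r V E R c x"
  unfolding lp_cost_def using comp_cost_nonneg
  by (intro sum_nonneg mult_nonneg_nonneg) (auto simp: lp_feasible_def)

lemma integrality_gap_le:
  assumes qb: "quasi_bipartite b V E R" and r: "2 \<le> r"
  shows "integrality_gap r V E R c \<le> ereal ((2 * real b + 1) / (real b + 1))"
proof -
  define \<rho> where "\<rho> = (2 * real b + 1) / (real b + 1)"
  have \<rho>: "0 < \<rho>" by (simp add: \<rho>_def)
  define A where "A = (INF x\<in>ip_feasible r V E R. ereal (lp_cost r V E R c x))"
  define B where "B = (INF x\<in>lp_feasible r V E R. ereal (lp_cost r V E R c x))"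
  have le: "A \<le> ereal \<rho> * ereal (lp_cost r V E R c x)" if x: "x \<in> lp_feasible r V E R" for x
  proof -
    obtain y where y: "y \<in> ip_feasible r V E R"
      "(real b + 1) * lp_cost r V E R c y \<le> (2 * real b + 1) * lp_cost r V E R c x"
      using ip_le_lp[OF qb r x] by blast
    have "A \<le> ereal (lp_cost r V E R c y)" unfolding A_def by (rule INF_lower[OF y(1)])
    also have "lp_cost r V E R c y \<le> \<rho> * lp_cost r V E R c x"
      using y(2) by (simp add: \<rho>_def field_simps)
    finally show ?thesis by simp
  qed
  have A0: "0 \<le> A" unfolding A_def
    by (rule INF_greatest) (use lp_cost_nonneg in \<open>auto simp: ip_feasible_def\<close>)
  obtain x0 where x0: "x0 \<in> lp_feasible r V E R"
    using connected_family_ip(1)[OF connected_family_all[OF r]] by (auto simp: ip_feasible_def)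
  have B0: "0 \<le> B" unfolding B_def
    by (rule INF_greatest) (use lp_cost_nonneg in auto)
  have "B \<le> ereal (lp_cost r V E R c x0)" unfolding B_def by (rule INF_lower[OF x0])
  then obtain \<beta> where \<beta>: "B = ereal \<beta>" using B0 by (cases B) auto
  have "A \<le> ereal (\<rho> * lp_cost r V E R c x0)" using le[OF x0] by simp
  then obtain \<alpha> where \<alpha>: "A = ereal \<alpha>" using A0 by (cases A) auto
  have "ereal (\<alpha> / \<rho>) \<le> B" unfolding B_def
  proof (rule INF_greatest)
    fix x assume "x \<in> lp_feasible r V E R"
    then show "ereal (\<alpha> / \<rho>) \<le> ereal (lp_cost r V E R c x)"
      using le[of x] \<rho> by (simp add: \<alpha> field_simps)
  qed
  then have "\<alpha> \<le> \<rho> * \<beta>" using \<rho> by (simp add: \<beta> field_simps)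
  \<comment> \<open>If \<open>\<beta> = 0\<close>, then \<open>\<alpha> = 0\<close> as well, and the
    quotient \<open>0 / 0\<close> is \<open>0\<close>.\<close>
  then have "A / B \<le> ereal \<rho>"
    using A0 B0 \<rho> by (cases "\<beta> = 0") (auto simp: \<alpha> \<beta> field_simps zero_ereal_def[symmetric])
  then show ?thesis unfolding integrality_gap_def A_def B_def \<rho>_def .
qed

end

section \<open>Skutella's instance\<close>

text \<open>
  Terminal \<open>0\<close> is a root, \<open>1, \<dots>, 7\<close> are the points of the Fano plane with lines
  \<open>{j, j + 1, j + 3}\<close> modulo 7, and each Steiner vertex is adjacent at unit cost to the root and
  to the complement of a line.
\<close>

definition fano_R :: "nat set" where "fano_R = {0..7}"

definition fano_S :: "nat set" where "fano_S = {8..14}"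

text \<open>The offsets 2, 4, 5, 6 are the residues outside the line \<open>{0, 1, 3}\<close>; the
  residue \<open>i\<close> stands for the terminal \<open>i + 1\<close>.\<close>

definition fano_N :: "nat \<Rightarrow> nat set" where
  "fano_N s = {0, 1 + (s + 2) mod 7, 1 + (s + 4) mod 7, 1 + (s + 5) mod 7, 1 + (s + 6) mod 7}"

definition fano_E :: "nat set set" where
  "fano_E = {{u, v} |u v. u \<in> fano_R \<and> v \<in> fano_R \<union> fano_S \<and> u \<noteq> v}"

text \<open>The costs are distances for unit edges between each \<open>s\<close> and
  \<open>fano_N s\<close>: any two terminals have a common neighbor, so distinct terminals are at
  distance 2, and a Steiner vertex is at distance 3 from a terminal that is not its
  neighbor.\<close>

definition fano_c :: "nat set \<Rightarrow> real" where
  "fano_c e = (if e \<subseteq> fano_R then 2 else if \<exists>s\<in>fano_S. \<exists>t\<in>fano_N s. e = {s, t} then 1 else 3)"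

section \<open>Incidences in the Fano plane\<close>

lemma fano_S_list: "fano_S = {8, 9, 10, 11, 12, 13, 14}"
  unfolding fano_S_def by auto

lemma fano_R_list: "fano_R = {0, 1, 2, 3, 4, 5, 6, 7}"
  unfolding fano_R_def by auto

lemma fano_N_sub: "fano_N s \<subseteq> fano_R"
proof -
  have "(1::nat) + n mod 7 \<le> 7" for n using mod_less_divisor[of 7 n] by linarith
  then show ?thesis by (auto simp: fano_N_def fano_R_def)
qed

lemma fano_N_simps:
  "fano_N 8 = {0, 4, 6, 7, 1}"
  "fano_N 9 = {0, 5, 7, 1, 2}"
  "fano_N 10 = {0, 6, 1, 2, 3}"
  "fano_N 11 = {0, 7, 2, 3, 4}"
  "fano_N 12 = {0, 1, 3, 4, 5}"
  "fano_N 13 = {0, 2, 4, 5, 6}"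
  "fano_N 14 = {0, 3, 5, 6, 7}"
  by (simp_all add: fano_N_def) (simp_all add: numeral_eq_Suc)

lemma fano_card_N: "s \<in> fano_S \<Longrightarrow> card (fano_N s) = 5"
proof -
  have "\<forall>s\<in>fano_S. card (fano_N s) = 5" by (simp add: fano_R_list fano_S_list fano_N_simps)
  then show "s \<in> fano_S \<Longrightarrow> card (fano_N s) = 5" by blast
qed

lemma fano_inj: "inj_on fano_N fano_S"
proof -
  have "\<forall>s\<in>fano_S. \<forall>s'\<in>fano_S. fano_N s = fano_N s' \<longrightarrow> s = s'"
    by (simp add: set_eq_subset fano_R_list fano_S_list fano_N_simps)
  then show ?thesis by (auto simp: inj_on_def)
qed

text \<open>Each point lies on three of the seven lines, hence in the complements of four; the root
  is adjacent to all Steiner vertices.\<close>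

lemma fano_degree: "t \<in> fano_R \<Longrightarrow> 4 \<le> card {s \<in> fano_S. t \<in> fano_N s}"
proof -
  have "card {s \<in> fano_S. t \<in> fano_N s} = (\<Sum>s\<in>fano_S. if t \<in> fano_N s then 1 else 0)" for t
    unfolding card_eq_sum by (rule sum.inter_filter) (simp add: fano_S_list)
  then have "\<forall>t\<in>fano_R. 4 \<le> card {s \<in> fano_S. t \<in> fano_N s}"
    by (simp add: fano_R_list fano_S_list fano_N_simps)
  then show "t \<in> fano_R \<Longrightarrow> 4 \<le> card {s \<in> fano_S. t \<in> fano_N s}" by blast
qed

text \<open>Two distinct points lie on five lines altogether, so two lines avoid both.\<close>

lemma fano_common: "u \<in> fano_R \<Longrightarrow> v \<in> fano_R \<Longrightarrow> \<exists>s\<in>fano_S. u \<in> fano_N s \<and> v \<in> fano_N s"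
proof -
  have "\<forall>u\<in>fano_R. \<forall>v\<in>fano_R. \<exists>s\<in>fano_S. u \<in> fano_N s \<and> v \<in> fano_N s" by (simp add: fano_R_list fano_S_list fano_N_simps)
  then show "u \<in> fano_R \<Longrightarrow> v \<in> fano_R \<Longrightarrow> \<exists>s\<in>fano_S. u \<in> fano_N s \<and> v \<in> fano_N s" by blast
qed

text \<open>Any two lines meet, and a common point lies in neither complement.\<close>

lemma fano_not_cover: "s \<in> fano_S \<Longrightarrow> s' \<in> fano_S \<Longrightarrow> \<not> fano_R \<subseteq> fano_N s \<union> fano_N s'"
proof -
  have "\<forall>s\<in>fano_S. \<forall>s'\<in>fano_S. \<not> fano_R \<subseteq> fano_N s \<union> fano_N s'" by (simp add: fano_R_list fano_S_list fano_N_simps)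
  then show "s \<in> fano_S \<Longrightarrow> s' \<in> fano_S \<Longrightarrow> \<not> fano_R \<subseteq> fano_N s \<union> fano_N s'" by blast
qed

lemma fano_disj: "fano_R \<inter> fano_S = {}"
  by (auto simp: fano_R_def fano_S_def)

lemma fano_finite: "finite fano_R" "finite fano_S" "card fano_R = 8" "card fano_S = 7"
  by (simp_all add: fano_R_def fano_S_def)

section \<open>Distances and preprocessing\<close>

lemma fano_edge_iff:
  "{u, v} \<in> fano_E \<longleftrightarrow> u \<noteq> v \<and> (u \<in> fano_R \<and> v \<in> fano_R \<union> fano_S \<or> v \<in> fano_R \<and> u \<in> fano_R \<union> fano_S)"
proof
  assume "{u, v} \<in> fano_E"
  then obtain a b where "{u, v} = {a, b}" "a \<in> fano_R" "b \<in> fano_R \<union> fano_S" "a \<noteq> b"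
    unfolding fano_E_def by blast
  then show "u \<noteq> v \<and> (u \<in> fano_R \<and> v \<in> fano_R \<union> fano_S \<or> v \<in> fano_R \<and> u \<in> fano_R \<union> fano_S)"
    by (auto simp: doubleton_eq_iff)
next
  assume "u \<noteq> v \<and> (u \<in> fano_R \<and> v \<in> fano_R \<union> fano_S \<or> v \<in> fano_R \<and> u \<in> fano_R \<union> fano_S)"
  then show "{u, v} \<in> fano_E"
  proof (elim conjE disjE)
    assume "u \<noteq> v" "v \<in> fano_R" "u \<in> fano_R \<union> fano_S"
    moreover have "{u, v} = {v, u}" by auto
    ultimately show ?thesis unfolding fano_E_def by blast
  qed (auto simp: fano_E_def)
qed

lemma fano_c_RR: "u \<in> fano_R \<Longrightarrow> v \<in> fano_R \<Longrightarrow> fano_c {u, v} = 2"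
  by (simp add: fano_c_def)

lemma fano_c_SR:
  assumes "s \<in> fano_S" "t \<in> fano_R"
  shows "fano_c {s, t} = (if t \<in> fano_N s then 1 else 3)"
proof -
  have "\<not> {s, t} \<subseteq> fano_R" using assms fano_disj by auto
  moreover have "(\<exists>s'\<in>fano_S. \<exists>t'\<in>fano_N s'. {s, t} = {s', t'}) \<longleftrightarrow> t \<in> fano_N s"
  proof
    assume "\<exists>s'\<in>fano_S. \<exists>t'\<in>fano_N s'. {s, t} = {s', t'}"
    then obtain s' t' where st: "s' \<in> fano_S" "t' \<in> fano_N s'" "{s, t} = {s', t'}" by blast
    then have "t' \<in> fano_R" using fano_N_sub by blast
    then have "s \<noteq> t'" using assms(1) fano_disj by blast
    then show "t \<in> fano_N s" using st by (auto simp: doubleton_eq_iff)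
  qed (use assms in blast)
  ultimately show ?thesis unfolding fano_c_def by simp
qed

lemma fano_c_bounds: "1 \<le> fano_c e" "fano_c e \<le> 3"
  by (auto simp: fano_c_def)

lemma fano_path_cost_length:
  "real (length p) - 1 \<le> path_cost fano_c p"
proof (induction p rule: induct_list012)
  case (3 x y zs)
  then show ?case using fano_c_bounds(1)[of "{x, y}"] by (simp add: path_cost_def)
qed (simp_all add: path_cost_def)

text \<open>Edges cost between 1 and 3, so three or more edges never beat a direct one. With two
  edges only a Steiner end is critical: the middle vertex is then a terminal, and the cost is at
  least \<open>2 + 1\<close>.\<close>

lemma fano_shortest:
  assumes u: "u \<in> fano_R" and v: "v \<in> fano_R \<union> fano_S" and uv: "u \<noteq> v"
    and q: "is_path fano_E u v q"
  shows "fano_c {u, v} \<le> path_cost fano_c q"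
proof -
  consider "length q \<le> 1" | "length q = 2" | "length q = 3" | "4 \<le> length q" by linarith
  then show ?thesis
  proof cases
    case 1
    then have "length q = 1" using q by (cases q) (auto simp: is_path_def)
    then obtain x where "q = [x]" by (auto simp: length_Suc_conv)
    then show ?thesis using q uv by (simp add: is_path_def)
  next
    case 2
    then obtain x y where "q = [x, y]" by (auto simp: length_Suc_conv numeral_2_eq_2)
    then show ?thesis using q by (simp add: is_path_def path_cost_def)
  next
    case 3
    then obtain x y z where "q = [x, y, z]" by (auto simp: length_Suc_conv numeral_3_eq_3)
    then have qe: "q = [u, y, v]" "{u, y} \<in> fano_E" "{y, v} \<in> fano_E" using q by (auto simp: is_path_def)
    then have cost: "path_cost fano_c q = fano_c {u, y} + fano_c {y, v}" by (simp add: path_cost_def)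
    show ?thesis
    proof (cases "v \<in> fano_R")
      case True
      then show ?thesis using u cost fano_c_RR fano_c_bounds(1)[of "{u, y}"] fano_c_bounds(1)[of "{y, v}"] by simp
    next
      case False
      then have "y \<in> fano_R" using qe(3) by (auto simp: fano_edge_iff)
      then show ?thesis using u cost fano_c_RR fano_c_bounds(1)[of "{y, v}"] fano_c_bounds(2)[of "{u, v}"] by simp
    qed
  next
    case 4
    then show ?thesis using fano_path_cost_length[of q] fano_c_bounds(2)[of "{u, v}"] by linarith
  qed
qed

lemma fano_shortest_edge:
  assumes "u \<in> fano_R" "v \<in> fano_R \<union> fano_S" "u \<noteq> v"
  shows "shortest_edge fano_E fano_c u v"
proof -
  have e: "{u, v} \<in> fano_E" using assms by (simp add: fano_edge_iff)
  have c: "path_cost fano_c [u, v] = fano_c {u, v}" by (simp add: path_cost_def)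
  have "is_shortest_path fano_E fano_c u v [u, v]"
    unfolding is_shortest_path_def c using fano_shortest[OF assms] e assms(3) by (simp add: is_path_def)
  then show ?thesis unfolding shortest_edge_def using e c by metis
qed

lemma fano_instance: "steiner_instance (fano_R \<union> fano_S) fano_E fano_R fano_c"
proof -
  have "e \<subseteq> fano_R \<union> fano_S \<and> card e = 2" if "e \<in> fano_E" for e
    using that unfolding fano_E_def by auto
  moreover have "0 \<le> fano_c e" for e using fano_c_bounds(1)[of e] by simp
  ultimately show ?thesis using fano_finite by (simp add: steiner_instance_def simple_graph_def)
qed

lemma fano_nbhd: "steiner_nbhd (fano_R \<union> fano_S) fano_E fano_R v \<subseteq> {v}"
proof
  fix u assume "u \<in> steiner_nbhd (fano_R \<union> fano_S) fano_E fano_R v"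
  then obtain p where p: "is_path {e \<in> fano_E. e \<subseteq> fano_R \<union> fano_S - fano_R} v u p"
    unfolding steiner_nbhd_def by blast
  have "{e \<in> fano_E. e \<subseteq> fano_R \<union> fano_S - fano_R} = {}" unfolding fano_E_def by auto
  then have "is_path {} v u p" using p by metis
  then show "u \<in> {v}" by (cases p rule: remdups_adj.cases) (auto simp: is_path_def)
qed

lemma fano_preprocessed: "preprocessed (fano_R \<union> fano_S) fano_E fano_R fano_c"
  unfolding preprocessed_def using fano_shortest_edge fano_nbhd by blast

lemma fano_quasi_bipartite:
  assumes "1 \<le> b" shows "quasi_bipartite b (fano_R \<union> fano_S) fano_E fano_R"
  unfolding quasi_bipartite_def
proof
  fix v
  have "card (steiner_nbhd (fano_R \<union> fano_S) fano_E fano_R v) \<le> card {v}"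
    by (rule card_mono[OF _ fano_nbhd]) simp
  then show "card (steiner_nbhd (fano_R \<union> fano_S) fano_E fano_R v) \<le> b" using assms by simp
qed

interpretation fano: steiner "fano_R \<union> fano_S" fano_E fano_R fano_c
  by unfold_locales (rule fano_instance, rule fano_preprocessed)

section \<open>The fractional solution\<close>

abbreviation fano_comps :: "nat \<Rightarrow> nat set set" where
  "fano_comps r \<equiv> full_comps r (fano_R \<union> fano_S) fano_E fano_R"

abbreviation fano_cost :: "nat set \<Rightarrow> real" where
  "fano_cost \<equiv> comp_cost (fano_R \<union> fano_S) fano_E fano_R fano_c"

lemma fano_star:
  assumes s: "s \<in> fano_S" and r: "5 \<le> r"
  shows "fano_N s \<in> fano_comps r" "fano_cost (fano_N s) \<le> 5"
proof -
  let ?F = "(\<lambda>t. {s, t}) ` fano_N s"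
  have sR: "s \<notin> fano_R" using s fano_disj by blast
  have "fano.semi_full (fano_N s) ?F"
    unfolding fano.semi_full_def
  proof (intro conjI ballI)
    show "?F \<subseteq> fano_E" using s sR fano_N_sub[of s] by (auto simp: fano_edge_iff subset_iff)
    show "\<Union>?F \<inter> fano_R \<subseteq> fano_N s" using sR by auto
    show "degree ?F k \<le> 1" if "k \<in> fano_N s" for k
    proof -
      have "k \<noteq> s" using that sR fano_N_sub by blast
      then have "{e \<in> ?F. k \<in> e} \<subseteq> {{s, k}}" by auto
      then have "card {e \<in> ?F. k \<in> e} \<le> card {{s, k}}" by (rule card_mono[rotated]) simp
      then show ?thesis by (simp add: degree_def)
    qed
    have "conn ?F s t" if "t \<in> fano_N s" for t using that by (intro conn_edge) auto
    then show "conn ?F k l" if "k \<in> fano_N s" "l \<in> fano_N s" for k l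
      using that by (rule_tac conn_via[of _ s]) auto
  qed
  moreover have "2 \<le> card (fano_N s)" "card (fano_N s) \<le> r" using fano_card_N[OF s] r by simp_all
  ultimately have "fano_N s \<in> fano_comps r" "fano_cost (fano_N s) \<le> sum fano_c ?F"
    using fano.semi_full_comp[of "fano_N s" ?F r] fano_N_sub by blast+
  moreover have "sum fano_c ?F \<le> 5"
  proof -
    have fin: "finite (fano_N s)" by (simp add: fano_N_def)
    have "sum fano_c ?F \<le> (\<Sum>t\<in>fano_N s. fano_c {s, t})"
      using sum_image_le[OF fin, of fano_c "\<lambda>t. {s, t}"] fano_c_bounds(1) by (force simp: o_def intro: order_trans[of 0 1])
    also have "\<dots> = (\<Sum>t\<in>fano_N s. 1)"
      by (rule sum.cong) (use s fano_N_sub in \<open>auto simp: fano_c_SR subset_iff\<close>)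
    finally show ?thesis using fano_card_N[OF s] by simp
  qed
  ultimately show "fano_N s \<in> fano_comps r" "fano_cost (fano_N s) \<le> 5" by simp_all
qed

text \<open>Four stars contain any given terminal other than the root, so weight
  \<open>1 / 4\<close> covers it exactly once.\<close>

definition fano_x :: "nat set \<Rightarrow> real" where
  "fano_x K = (if K \<in> fano_N ` fano_S then 1 / 4 else 0)"

lemma fano_x_sum:
  assumes "5 \<le> r"
  shows "(\<Sum>K\<in>fano_comps r. h K * fano_x K) = (\<Sum>s\<in>fano_S. h (fano_N s)) / 4"
proof -
  have "(\<Sum>K\<in>fano_comps r. h K * fano_x K) = (\<Sum>K\<in>fano_N ` fano_S. h K * (1 / 4))"
    by (rule sum.mono_neutral_cong_right)
      (use fano.finite_full_comps fano_star(1) assms in \<open>auto simp: fano_x_def\<close>)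
  also have "\<dots> = (\<Sum>s\<in>fano_S. h (fano_N s) * (1 / 4))"
    using sum.reindex[OF fano_inj] by simp
  finally show ?thesis by (simp add: sum_divide_distrib)
qed

text \<open>
  All components contain the root, so only parts without the root count, and every terminal in
  such a part lies in four of the components.
\<close>

lemma fano_x_feasible:
  assumes r: "5 \<le> r"
  shows "fano_x \<in> lp_feasible r (fano_R \<union> fano_S) fano_E fano_R"
  unfolding lp_feasible_def mem_Collect_eq fano_x_sum[OF r]
proof (intro conjI ballI allI impI)
  show "0 \<le> fano_x K" for K by (simp add: fano_x_def)
  fix \<pi> assume \<pi>: "partition_on fano_R \<pi>"
  have fin\<pi>: "finite \<pi>" using \<pi> fano_finite(1) finite_elements by blast
  have "0 \<in> fano_R" by (simp add: fano_R_def)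
  then obtain P0 where P0: "P0 \<in> \<pi>" "0 \<in> P0" using \<pi> by (auto simp: partition_on_def)
  let ?\<pi> = "\<pi> - {P0}"
  have rc: "rank_contrib \<pi> (fano_N s) = (\<Sum>P\<in>?\<pi>. if P \<inter> fano_N s \<noteq> {} then 1 else 0)" for s
  proof -
    have "0 \<in> fano_N s" by (simp add: fano_N_def)
    then have "{P \<in> \<pi>. P \<inter> fano_N s \<noteq> {}} = insert P0 {P \<in> ?\<pi>. P \<inter> fano_N s \<noteq> {}}"
      using P0 by auto
    then have "rank_contrib \<pi> (fano_N s) = real (card {P \<in> ?\<pi>. P \<inter> fano_N s \<noteq> {}})"
      using fin\<pi> by (simp add: rank_contrib_def)
    also have "\<dots> = (\<Sum>P | P \<in> ?\<pi> \<and> P \<inter> fano_N s \<noteq> {}. 1)" by simp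
    also have "\<dots> = (\<Sum>P\<in>?\<pi>. if P \<inter> fano_N s \<noteq> {} then 1 else 0)"
      by (rule sum.inter_filter) (use fin\<pi> in simp)
    finally show ?thesis .
  qed
  have four: "4 \<le> (\<Sum>s\<in>fano_S. if P \<inter> fano_N s \<noteq> {} then 1 else (0::real))" if P: "P \<in> ?\<pi>" for P
  proof -
    have "P \<noteq> {}" "P \<subseteq> fano_R" using P \<pi> by (auto simp: partition_on_def)
    then obtain t where t: "t \<in> P" "t \<in> fano_R" by blast
    have "4 \<le> real (card {s \<in> fano_S. t \<in> fano_N s})" using fano_degree[OF t(2)] by simp
    also have "\<dots> \<le> real (card {s \<in> fano_S. P \<inter> fano_N s \<noteq> {}})"
      using t fano_finite by (intro of_nat_mono card_mono) auto
    also have "\<dots> = (\<Sum>s | s \<in> fano_S \<and> P \<inter> fano_N s \<noteq> {}. 1)" by simp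
    also have "\<dots> = (\<Sum>s\<in>fano_S. if P \<inter> fano_N s \<noteq> {} then 1 else 0)"
      by (rule sum.inter_filter) (simp add: fano_finite)
    finally show ?thesis .
  qed
  have "real (card \<pi>) - 1 = real (card ?\<pi>)"
    using P0 fin\<pi> card_Suc_Diff1[OF fin\<pi> P0(1)] by linarith
  also have "\<dots> = (\<Sum>P\<in>?\<pi>. 4) / 4" by simp
  also have "\<dots> \<le> (\<Sum>P\<in>?\<pi>. \<Sum>s\<in>fano_S. if P \<inter> fano_N s \<noteq> {} then 1 else 0) / 4"
    by (intro divide_right_mono sum_mono four) simp_all
  also have "\<dots> = (\<Sum>s\<in>fano_S. rank_contrib \<pi> (fano_N s)) / 4"
    unfolding rc by (subst sum.swap) simp
  finally show "real (card \<pi>) - 1 \<le> (\<Sum>s\<in>fano_S. rank_contrib \<pi> (fano_N s)) / 4" .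
qed

lemma fano_x_cost:
  assumes "5 \<le> r"
  shows "lp_cost r (fano_R \<union> fano_S) fano_E fano_R fano_c fano_x \<le> 35 / 4"
proof -
  have "(\<Sum>s\<in>fano_S. fano_cost (fano_N s)) \<le> (\<Sum>s\<in>fano_S. 5)"
    by (rule sum_mono) (rule fano_star(2)[OF _ assms])
  then show ?thesis unfolding lp_cost_def fano_x_sum[OF assms] by (simp add: fano_finite)
qed

section \<open>Integral solutions cost at least ten\<close>

text \<open>Terminals are leaves and Steiner vertices are not adjacent, so an optimal component is
  an edge between two terminals or a star at one Steiner vertex. The edge costs 2 and its ends have
  a common neighbor. A star pays at least 1 per terminal, and 3 at a terminal outside
  \<open>fano_N v\<close>, which is the surplus of 2.\<close>

lemma fano_comp_cost_ge:
  assumes K: "K \<in> fano_comps r"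
  shows "(\<exists>s\<in>fano_S. K \<subseteq> fano_N s) \<and> real (card K) \<le> fano_cost K \<or> real (card K) + 2 \<le> fano_cost K"
proof -
  obtain F where F: "fano.optimal K F" "K \<subseteq> fano_R" "2 \<le> card K" "fano_cost K = sum fano_c F"
    using fano.full_comps_optimal[OF K] .
  note FE = fano.opt_sub[OF F(1-3)] and terms = fano.opt_terms[OF F(1-3)]
    and finF = fano.opt_finite[OF F(1-3)]
  have finK: "finite K" using F(2) fano_finite finite_subset by blast
  have leaf: "w = y" if "{y, t} \<in> F" "{t, w} \<in> F" "t \<in> fano_R" for y t w
  proof -
    have "t \<in> K" using that terms by auto
    then have "card {e \<in> F. t \<in> e} = 1" using fano.opt_degree_term[OF F(1-3)] by (simp add: degree_def)
    then obtain e where e: "{e \<in> F. t \<in> e} = {e}" by (metis card_1_singletonE)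
    have "{y, t} \<in> {e \<in> F. t \<in> e}" "{t, w} \<in> {e \<in> F. t \<in> e}" using that by auto
    then show ?thesis unfolding e by (auto simp: doubleton_eq_iff)
  qed
  obtain k0 where k0: "k0 \<in> K" using F(3) by fastforce
  obtain e where "e \<in> F" "k0 \<in> e" using fano.opt_term_cover[OF F(1-3) k0] by blast
  then obtain v where v: "{k0, v} \<in> F" "k0 \<noteq> v" using fano.edge_memE FE by (metis subsetD)
  have reach: "conn F k0 k" if "k \<in> K" for k using fano.opt_conn[OF F(1-3) k0 that] .
  show ?thesis
  proof (cases "v \<in> fano_R")
    case True
    have "y = k0 \<or> y = v" if "conn F k0 y" for y
      using that
    proof (induction rule: conn_induct)
      case (step y z)
      then show ?case
        using leaf[of v k0 z] leaf[of k0 v z] v True k0 F(2) by (auto simp: insert_commute)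
    qed simp
    then have Kv: "K \<subseteq> {k0, v}" using reach by blast
    then have "card K \<le> 2" using card_mono[OF _ Kv] v(2) by simp
    have "fano_c {k0, v} = 2" using fano_c_RR True k0 F(2) by blast
    moreover have "sum fano_c {{k0, v}} \<le> sum fano_c F"
      by (rule fano.sum_mono_E) (use v FE in auto)
    ultimately have "real (card K) \<le> fano_cost K" using \<open>card K \<le> 2\<close> F(4) by simp
    moreover have "\<exists>s\<in>fano_S. K \<subseteq> fano_N s" using fano_common[of k0 v] True k0 F(2) Kv by blast
    ultimately show ?thesis by blast
  next
    case False
    then have vS: "v \<in> fano_S" using v FE by (auto simp: fano_edge_iff)
    have "y = v \<or> {v, y} \<in> F \<and> y \<in> fano_R" if "conn F k0 y" for y
      using that
    proof (induction rule: conn_induct)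
      case base
      then show ?case using v k0 F(2) by (auto simp: insert_commute)
    next
      case (step y z)
      have yz: "{y, z} \<in> F" using step by blast
      from step.IH show ?case
      proof
        assume "y = v"
        then show ?thesis using yz FE False by (auto simp: fano_edge_iff)
      next
        assume "{v, y} \<in> F \<and> y \<in> fano_R"
        then show ?thesis using leaf[of v y z] yz by blast
      qed
    qed
    then have star: "{v, k} \<in> F" if "k \<in> K" for k using reach[OF that] that F(2) False by blast
    have inj: "inj_on (\<lambda>k. {v, k}) K"
      using False F(2) by (intro inj_onI) (auto simp: doubleton_eq_iff)
    have "(\<Sum>k\<in>K. fano_c {v, k}) = sum fano_c ((\<lambda>k. {v, k}) ` K)"
      using sum.reindex[OF inj, of fano_c] by (simp add: o_def)
    also have "\<dots> \<le> sum fano_c F" by (rule fano.sum_mono_E) (use star FE in auto)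
    finally have le: "(\<Sum>k\<in>K. fano_c {v, k}) \<le> fano_cost K" using F(4) by simp
    show ?thesis
    proof (cases "K \<subseteq> fano_N v")
      case True
      have "(\<Sum>k\<in>K. 1) \<le> (\<Sum>k\<in>K. fano_c {v, k})" by (rule sum_mono) (rule fano_c_bounds)
      then show ?thesis using le True vS by auto
    next
      case nsub: False
      then obtain k1 where k1: "k1 \<in> K" "k1 \<notin> fano_N v" by blast
      have "real (card K) + 2 = (\<Sum>k\<in>K - {k1}. 1) + 3"
        using card_Suc_Diff1[OF finK k1(1)] by simp
      also have "\<dots> \<le> (\<Sum>k\<in>K - {k1}. fano_c {v, k}) + fano_c {v, k1}"
        using k1 F(2) fano_c_SR[OF vS, of k1] by (intro add_mono sum_mono fano_c_bounds) auto
      also have "\<dots> = (\<Sum>k\<in>K. fano_c {v, k})" using finK k1 by (simp add: sum.remove)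
      finally show ?thesis using le by simp
    qed
  qed
qed

text \<open>With \<open>n\<close> components counted with multiplicity, the cost is at least
  \<open>7 + n\<close>. This suffices for \<open>3 \<le> n\<close>, and also if some component in
  use fits into no \<open>fano_N s\<close>, since its surplus of 2 and \<open>1 \<le> n\<close> give
  ten. Otherwise at most two components are used, each inside some \<open>fano_N s\<close>, and they
  miss a terminal.\<close>

lemma fano_ip_cost:
  assumes x: "x \<in> ip_feasible r (fano_R \<union> fano_S) fano_E fano_R"
  shows "10 \<le> lp_cost r (fano_R \<union> fano_S) fano_E fano_R fano_c x"
proof -
  let ?C = "fano_comps r"
  have lp: "x \<in> lp_feasible r (fano_R \<union> fano_S) fano_E fano_R" and
    int: "\<And>K. K \<in> ?C \<Longrightarrow> x K \<in> \<int>"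
    using x by (auto simp: ip_feasible_def)
  have pos: "0 \<le> x K" if "K \<in> ?C" for K using lp that by (simp add: lp_feasible_def)
  have finC: "finite ?C" by (rule fano.finite_full_comps)
  define n where "n = sum x ?C"
  define supp where "supp = {K \<in> ?C. x K \<noteq> 0}"
  have finsupp: "finite supp" using finC by (simp add: supp_def)
  have ge1: "1 \<le> x K" if "K \<in> supp" for K
  proof -
    have K: "K \<in> ?C" "x K \<noteq> 0" using that by (simp_all add: supp_def)
    obtain z where "x K = of_int z" using int[OF K(1)] by (rule Ints_cases)
    then show ?thesis using pos[OF K(1)] K(2) by simp
  qed
  have size: "7 + n \<le> (\<Sum>K\<in>?C. real (card K) * x K)"
  proof -
    \<comment> \<open>The identity stands for the partition into singletons.\<close>
    have "real (card (id ` fano_R)) - 1 \<le> (\<Sum>K\<in>?C. (real (card (id ` K)) - 1) * x K)"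
      by (rule lp_function_constraint[OF lp fano_finite(1)])
    then show ?thesis by (simp add: fano_finite n_def left_diff_distrib sum_subtractf)
  qed
  have cost_ge: "real (card K) * x K \<le> fano_cost K * x K" if "K \<in> ?C" for K
    using fano_comp_cost_ge[OF that] pos[OF that] by (intro mult_right_mono) auto
  have n_ge: "x K \<le> n" if "K \<in> ?C" for K
    unfolding n_def using that finC pos by (intro member_le_sum) auto
  have lpc: "lp_cost r (fano_R \<union> fano_S) fano_E fano_R fano_c x = (\<Sum>K\<in>?C. fano_cost K * x K)"
    by (simp add: lp_cost_def)
  consider "3 \<le> n" | K where "K \<in> supp" "\<not> (\<exists>s\<in>fano_S. K \<subseteq> fano_N s)"
    | "n < 3" "\<forall>K\<in>supp. \<exists>s\<in>fano_S. K \<subseteq> fano_N s" by fastforce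
  then show ?thesis
  proof cases
    case 1
    have "(\<Sum>K\<in>?C. real (card K) * x K) \<le> (\<Sum>K\<in>?C. fano_cost K * x K)"
      by (rule sum_mono) (rule cost_ge)
    then show ?thesis using size 1 unfolding lpc by simp
  next
    case 2
    have KC: "K \<in> ?C" using 2 by (simp add: supp_def)
    have "real (card K) + 2 \<le> fano_cost K" using fano_comp_cost_ge[OF KC] 2 by blast
    then have "(real (card K) + 2) * x K \<le> fano_cost K * x K" using pos[OF KC] by (rule mult_right_mono)
    then have K2: "real (card K) * x K + 2 \<le> fano_cost K * x K"
      using ge1[OF 2(1)] by (simp add: distrib_right)
    have "7 + n + 2 \<le> real (card K) * x K + 2 + (\<Sum>K\<in>?C - {K}. real (card K) * x K)"
      using size sum.remove[OF finC KC, of "\<lambda>K. real (card K) * x K"] by simp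
    also have "\<dots> \<le> fano_cost K * x K + (\<Sum>K\<in>?C - {K}. fano_cost K * x K)"
      by (intro add_mono K2 sum_mono cost_ge) auto
    also have "\<dots> = (\<Sum>K\<in>?C. fano_cost K * x K)"
      using sum.remove[OF finC KC, of "\<lambda>K. fano_cost K * x K"] by simp
    finally show ?thesis unfolding lpc using n_ge[OF KC] ge1[OF 2(1)] by simp
  next
    case 3
    then obtain h where h: "\<And>K. K \<in> supp \<Longrightarrow> h K \<in> fano_S" "\<And>K. K \<in> supp \<Longrightarrow> K \<subseteq> fano_N (h K)"
      by metis
    have "real (card supp) = (\<Sum>K\<in>supp. 1)" by simp
    also have "\<dots> \<le> sum x supp" by (rule sum_mono) (rule ge1)
    also have "\<dots> \<le> n" unfolding n_def
      by (rule sum_mono2[OF finC]) (use pos in \<open>auto simp: supp_def\<close>)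
    finally have "card supp \<le> 2" using 3(1) by linarith
    then have "card (h ` supp) \<le> 2" using card_image_le[OF finsupp, of h] by linarith
    then consider "card (h ` supp) = 0" | "card (h ` supp) = 1" | "card (h ` supp) = 2" by linarith
    then have "\<exists>s\<in>fano_S. \<exists>s'\<in>fano_S. h ` supp \<subseteq> {s, s'}"
    proof cases
      case 1
      moreover have "8 \<in> fano_S" by (simp add: fano_S_def)
      ultimately show ?thesis using finsupp by auto
    next
      case 2
      then obtain s where s: "h ` supp = {s}" by (metis card_1_singletonE)
      then have "s \<in> h ` supp" by simp
      then have "s \<in> fano_S" using h(1) by blast
      then show ?thesis using s by blast
    next
      case 3
      then obtain s s' where s: "h ` supp = {s, s'}" by (auto simp: card_2_iff)
      then have "s \<in> h ` supp" "s' \<in> h ` supp" by simp_all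
      then have "s \<in> fano_S" "s' \<in> fano_S" using h(1) by blast+
      then show ?thesis using s by blast
    qed
    then obtain s s' where s: "s \<in> fano_S" "s' \<in> fano_S" "h ` supp \<subseteq> {s, s'}" by blast
    have "\<exists>K\<in>supp. t \<in> K" if t: "t \<in> fano_R" for t
    proof (rule ccontr)
      assume no: "\<not> (\<exists>K\<in>supp. t \<in> K)"
      \<comment> \<open>The partition that separates \<open>t\<close> from the other terminals; no
        component in use contributes to its constraint.\<close>
      let ?f = "\<lambda>u. u = t"
      have "(real (card (?f ` K)) - 1) * x K \<le> 0" if K: "K \<in> ?C" for K
      proof (cases "K \<in> supp")
        case True
        then have "?f ` K \<subseteq> {False}" using no by auto
        then have "card (?f ` K) \<le> card {False}" by (rule card_mono[rotated]) simp
        then show ?thesis using pos[OF K] by (intro mult_nonpos_nonneg) auto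
      next
        case False
        then show ?thesis using K by (simp add: supp_def)
      qed
      then have "(\<Sum>K\<in>?C. (real (card (?f ` K)) - 1) * x K) \<le> 0" by (rule sum_nonpos)
      then have "real (card (?f ` fano_R)) - 1 \<le> 0"
        using lp_function_constraint[OF lp fano_finite(1), of ?f] by linarith
      moreover have "?f ` fano_R = {True, False}"
      proof -
        have "\<exists>u\<in>fano_R. u \<noteq> t" by (cases "t = 0") (auto simp: fano_R_def)
        then show ?thesis using t by (auto simp: image_iff)
      qed
      ultimately show False by simp
    qed
    then have "fano_R \<subseteq> fano_N s \<union> fano_N s'" using h(2) s(3) by blast
    then show ?thesis using fano_not_cover s by blast
  qed
qed

text \<open>The stars have five terminals, hence \<open>r = 5\<close>; the ratio is
  \<open>10 / (35 / 4)\<close>.\<close>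

lemma fano_gap:
  "ereal (8 / 7) \<le> integrality_gap 5 (fano_R \<union> fano_S) fano_E fano_R fano_c"
proof -
  define A where "A = (INF x\<in>ip_feasible 5 (fano_R \<union> fano_S) fano_E fano_R.
    ereal (lp_cost 5 (fano_R \<union> fano_S) fano_E fano_R fano_c x))"
  define B where "B = (INF x\<in>lp_feasible 5 (fano_R \<union> fano_S) fano_E fano_R.
    ereal (lp_cost 5 (fano_R \<union> fano_S) fano_E fano_R fano_c x))"
  have A: "ereal 10 \<le> A" unfolding A_def by (rule INF_greatest) (simp add: fano_ip_cost)
  have "B \<le> ereal (lp_cost 5 (fano_R \<union> fano_S) fano_E fano_R fano_c fano_x)"
    unfolding B_def by (rule INF_lower) (simp add: fano_x_feasible)
  also have "\<dots> \<le> ereal (35 / 4)" using fano_x_cost[of 5] by simp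
  finally have B: "B \<le> ereal (35 / 4)" .
  have B0: "0 \<le> B" unfolding B_def
    by (rule INF_greatest) (use fano.lp_cost_nonneg in auto)
  have "ereal (8 / 7) = ereal 10 / ereal (35 / 4)" by simp
  also have "\<dots> \<le> A / ereal (35 / 4)" using A by (intro ereal_divide_right_mono) auto
  also have "\<dots> \<le> A / B"
  proof (cases "B = 0")
    case True
    \<comment> \<open>Division of a positive value by zero gives infinity, so this case is
      harmless.\<close>
    have "0 < A" using A by (rule less_le_trans[rotated]) simp
    then show ?thesis using True by (simp add: divide_ereal_def)
  next
    case False
    have "0 < A" using A by (rule less_le_trans[rotated]) simp
    then show ?thesis using B B0 False by (intro ereal_divide_left_mono) (auto simp: less_le)
  qed
  finally show ?thesis unfolding integrality_gap_def A_def B_def .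
qed

theorem theorem2:
  fixes b :: nat
  assumes "1 \<le> b"
  shows
    "(\<forall>(r::nat) (V :: 'a set) E R c.
        2 \<le> r \<and> steiner_instance V E R c \<and> preprocessed V E R c \<and> quasi_bipartite b V E R \<longrightarrow>
        integrality_gap r V E R c \<le> ereal ((2 * real b + 1) / (real b + 1))) \<and>
     (\<exists>(r::nat) (V :: nat set) E R c.
        2 \<le> r \<and> steiner_instance V E R c \<and> preprocessed V E R c \<and>
        quasi_bipartite 1 V E R \<and> quasi_bipartite b V E R \<and>
        ereal (8 / 7) \<le> integrality_gap r V E R c) \<and>
     ereal (8 / 7) \<le> worst_case_gap b \<and>
     worst_case_gap b \<le> ereal ((2 * real b + 1) / (real b + 1))"
proof (intro conjI)
  show "\<forall>(r::nat) (V :: 'a set) E R c.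
      2 \<le> r \<and> steiner_instance V E R c \<and> preprocessed V E R c \<and> quasi_bipartite b V E R \<longrightarrow>
      integrality_gap r V E R c \<le> ereal ((2 * real b + 1) / (real b + 1))"
    by (intro allI impI steiner.integrality_gap_le) (auto intro: steiner.intro)
  show "\<exists>(r::nat) (V :: nat set) E R c.
      2 \<le> r \<and> steiner_instance V E R c \<and> preprocessed V E R c \<and>
      quasi_bipartite 1 V E R \<and> quasi_bipartite b V E R \<and>
      ereal (8 / 7) \<le> integrality_gap r V E R c"
    by (rule exI[of _ 5], rule exI[of _ "fano_R \<union> fano_S"], rule exI[of _ fano_E],
        rule exI[of _ fano_R], rule exI[of _ fano_c])
      (use fano_instance fano_preprocessed fano_quasi_bipartite[OF assms]
        fano_quasi_bipartite[of 1] fano_gap in simp)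
  have "integrality_gap 5 (fano_R \<union> fano_S) fano_E fano_R fano_c \<le> worst_case_gap b"
    unfolding worst_case_gap_def
    by (rule Sup_upper, rule CollectI, rule exI[of _ 5], rule exI[of _ "fano_R \<union> fano_S"],
        rule exI[of _ fano_E], rule exI[of _ fano_R], rule exI[of _ fano_c])
      (simp add: fano_instance fano_preprocessed fano_quasi_bipartite[OF assms])
  then show "ereal (8 / 7) \<le> worst_case_gap b" using fano_gap by (rule order_trans[rotated])
  show "worst_case_gap b \<le> ereal ((2 * real b + 1) / (real b + 1))"
    unfolding worst_case_gap_def
    by (rule Sup_least) (auto intro!: steiner.integrality_gap_le steiner.intro)
qed

end
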